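(* Let $p,q,s\ge1$ be integers and let $P$ be a $3$-way transportation polytope of size $p\times q\times s$ defined by $1$-marginals. Then the graph of $P$ has diameter at most $2(p+q+s-2)^2$.
   Context: Given vectors $u\in\mathbb{R}^p$, $v\in\mathbb{R}^q$, $w\in\mathbb{R}^s$ (the $1$-marginals), the $3$-way (axial) transportation polytope of size $p\times q\times s$ defined by them is the set of $x=(x_{i,j,k})\in\mathbb{R}_{\ge0}^{p\times q\times s}$ with $\sum_{j,k}x_{i,j,k}=u_i$ for all $i$, $\sum_{i,k}x_{i,j,k}=v_j$ for all $j$, and $\sum_{i,j}x_{i,j,k}=w_k$ for all $k$. The graph of a polytope has the vertices of the polytope as nodes and its edges (1-dimensional faces) as edges; its diameter is the maximum over pairs of vertices of the length of a shortest path. *)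

theory Defs
  imports "HOL-Analysis.Analysis" "Graph_Theory.Graph_Theory"
begin

(* Points of R^(p x q x s) are indexed by triples, so the coordinate x_{i,j,k} is x $ (i, j, k). *)
definition transportation_polytope ::
  "real ^ 'p \<Rightarrow> real ^ 'q \<Rightarrow> real ^ 's \<Rightarrow> (real ^ ('p::finite \<times> 'q::finite \<times> 's::finite)) set" where
  "transportation_polytope u v w =
     {x. (\<forall>i j k. 0 \<le> x $ (i, j, k)) \<and>
         (\<forall>i. (\<Sum>j\<in>UNIV. \<Sum>k\<in>UNIV. x $ (i, j, k)) = u $ i) \<and>
         (\<forall>j. (\<Sum>i\<in>UNIV. \<Sum>k\<in>UNIV. x $ (i, j, k)) = v $ j) \<and>
         (\<forall>k. (\<Sum>i\<in>UNIV. \<Sum>j\<in>UNIV. x $ (i, j, k)) = w $ k)}"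

(* An undirected graph is represented as a symmetric digraph. Two distinct vertices of a polytope
   lying on a common 1-dimensional face are the two endpoints of that face. *)
definition polytope_graph :: "'a::euclidean_space set \<Rightarrow> 'a pair_pre_digraph" where
  "polytope_graph P =
     \<lparr> pverts = {a. a extreme_point_of P},
       parcs = {(a, b). a extreme_point_of P \<and> b extreme_point_of P \<and> a \<noteq> b \<and>
                        (\<exists>e. e edge_of P \<and> a \<in> e \<and> b \<in> e)} \<rparr>"

(* The library constant wf_digraph.\<mu> is meaningful only for well-formed digraphs. *)
lemma wf_digraph_polytope_graph: "wf_digraph (with_proj (polytope_graph P))"
  by unfold_locales (auto simp: polytope_graph_def)

lemma sym_polytope_graph: "symmetric (with_proj (polytope_graph P))"
  by (auto simp: symmetric_def polytope_graph_def sym_def)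

(* With all arc costs equal to 1, the cost of a walk is its length and wf_digraph.\<mu> is the
   length of a shortest path (\<infinity> if there is none). The diameter is therefore \<infinity> for a
   disconnected graph; for the graph without vertices it is the empty supremum -\<infinity>. *)
definition graph_diameter :: "('a, 'b) pre_digraph \<Rightarrow> ereal" where
  "graph_diameter G = (SUP (a, b) \<in> verts G \<times> verts G. wf_digraph.\<mu> G (\<lambda>_. 1) a b)"

end

theory Submission
  imports Defs
begin

text \<open>
  Vertices are the points with linearly independent support, and a pivot follows an edge as soon as
  the cells involved carry a single circuit. Given indices \<open>i\<close>, \<open>j\<close>, the exchanges
  \<open>(i,b,c) + (a,j,c') \<rightarrow> (i,j,c) + (a,b,c')\<close> destroy, at the cost of at most one extra pivot for each
  \<open>c\<close>, all cells of slice \<open>i\<close> outside slice \<open>j\<close> or conversely; the smaller of the two margins decides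
  which. Doing this to both given vertices \<open>x\<close>, \<open>y\<close> eliminates one index, and after at most
  \<open>p + q - 2\<close> rounds both lie over a set \<open>H\<close> of at most \<open>p + q - 1\<close> pairs \<open>(i,j)\<close> whose margins are
  determined. There the polytope is a 2-way transportation polytope of size \<open>H \<times> s\<close>. Now some row or
  column of \<open>x\<close> has at most one cell in its support, and moving only \<open>y\<close> makes the two vertices agree on
  it. With \<open>r = p + q - 2\<close> the steps add up to at most
  \<open>r(r - 1) + 4rs + (r + s + 1)(r + s)/2 \<le> 2(r + s)\<^sup>2\<close>.
\<close>

section \<open>Graph distance\<close>

text \<open>Paths are encoded by relational powers, so that concatenation and reversal need no walk
  objects; the length is only bounded, since the pivot counts below are upper bounds.\<close>

definition near :: "'a::euclidean_space set \<Rightarrow> nat \<Rightarrow> 'a \<Rightarrow> 'a \<Rightarrow> bool" where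
  "near P n x y \<longleftrightarrow> (\<exists>m\<le>n. (x, y) \<in> parcs (polytope_graph P) ^^ m)"

lemma near_refl: "near P n x x"
  unfolding near_def by (intro exI[of _ 0]) auto

lemma near_adj: "(x, y) \<in> parcs (polytope_graph P) \<Longrightarrow> near P 1 x y"
  unfolding near_def by (intro exI[of _ 1]) auto

lemma near_trans: "near P m x y \<Longrightarrow> near P n y z \<Longrightarrow> near P (m + n) x z"
  unfolding near_def by (meson add_mono relpow_trans)

lemma near_mono: "near P m x y \<Longrightarrow> m \<le> n \<Longrightarrow> near P n x y"
  unfolding near_def by (meson order_trans)

lemma near_sym:
  assumes "near P n x y"
  shows "near P n y x"
proof -
  let ?R = "parcs (polytope_graph P)"
  have R: "(b, a) \<in> ?R" if "(a, b) \<in> ?R" for a b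
    using that by (auto simp: polytope_graph_def)
  have "(y, x) \<in> ?R ^^ m" if "(x, y) \<in> ?R ^^ m" for m
    using that
  proof (induction m arbitrary: y)
    case (Suc m)
    then obtain z where "(x, z) \<in> ?R ^^ m" "(z, y) \<in> ?R" by auto
    then show ?case using Suc.IH R by (meson relpow_Suc_I2)
  qed auto
  then show ?thesis using assms unfolding near_def by blast
qed

text \<open>A chain of arcs is an \<open>awalk\<close>, and with unit costs its length is its cost,
  which bounds \<open>\<mu>\<close> from above. A graph without vertices needs no separate case,
  since only members of the supremum are bounded.\<close>

lemma graph_diameter_le:
  assumes "\<And>x y. x extreme_point_of P \<Longrightarrow> y extreme_point_of P \<Longrightarrow> near P n x y"
  shows "graph_diameter (with_proj (polytope_graph P)) \<le> ereal (real n)"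
proof -
  let ?G = "with_proj (polytope_graph P)"
  interpret wf_digraph ?G by (rule wf_digraph_polytope_graph)
  have walk: "\<exists>p. awalk x p y \<and> length p = m"
    if "(x, y) \<in> parcs (polytope_graph P) ^^ m" "y \<in> verts ?G" for x y m
    using that
  proof (induction m arbitrary: x)
    case 0
    then show ?case by (auto simp: awalk_Nil_iff intro!: exI[of _ "[]"])
  next
    case (Suc m)
    then obtain z where z: "(x, z) \<in> parcs (polytope_graph P)"
      "(z, y) \<in> parcs (polytope_graph P) ^^ m"
      by (meson relpow_Suc_D2)
    then obtain p where "awalk z p y" "length p = m" using Suc by blast
    then show ?case using z(1) by (intro exI[of _ "(x, z) # p"]) (auto simp: awalk_Cons_iff)
  qed
  have "\<mu> (\<lambda>_. 1) x y \<le> ereal (real n)" if xy: "x \<in> verts ?G" "y \<in> verts ?G" for x y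
  proof -
    have "near P n x y"
      using xy by (intro assms) (auto simp: polytope_graph_def)
    then obtain m where m: "m \<le> n" "(x, y) \<in> parcs (polytope_graph P) ^^ m"
      unfolding near_def by blast
    then obtain p where p: "awalk x p y" "length p = m" using walk xy(2) by blast
    have "awalk_cost (\<lambda>_. 1) p = real (length p)" by (induction p) auto
    then have "\<mu> (\<lambda>_. 1) x y \<le> ereal (real m)"
      using min_cost_le_walk_cost[OF p(1), of "\<lambda>_. 1"] p(2) by simp
    also have "\<dots> \<le> ereal (real n)" using m(1) by simp
    finally show ?thesis .
  qed
  then show ?thesis unfolding graph_diameter_def by (intro SUP_least) auto
qed

text \<open>With \<open>r = a + b - 2\<close>, the right side minus the left side is
  \<open>(r - s)^2/2 + r/2 + (s^2 - s)/2 + s^2/2\<close>, a sum of nonnegative terms. The first sum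
  counts the elimination phase, the second the two-way phase.\<close>

lemma two_phase_bound:
  fixes a b s :: nat
  assumes "1 \<le> a" "1 \<le> b" "1 \<le> s"
  shows "(\<Sum>t<a + b - 2. 2 * (t + 2 * s)) + \<Sum>{..<a + b - 1 + s} \<le> 2 * (a + b + s - 2)\<^sup>2"
proof -
  obtain r where r: "a + b = r + 2" using assms by (metis add_mono le_add_diff_inverse2 one_add_one)
  have tri: "real (\<Sum>{..<n}) = real n * (real n - 1) / 2" for n
    by (induction n) (simp_all add: lessThan_Suc field_simps)
  have "(\<Sum>t<r. 2 * (t + 2 * s)) = 2 * \<Sum>{..<r} + 4 * r * s"
    by (simp add: sum.distrib flip: sum_distrib_left)
  then have "real (\<Sum>t<r. 2 * (t + 2 * s)) = 2 * real (\<Sum>{..<r}) + 4 * real r * real s"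
    by simp
  then have "real ((\<Sum>t<r. 2 * (t + 2 * s)) + \<Sum>{..<r + 1 + s})
    = real r * (real r - 1) + 4 * real r * real s + (real r + real s + 1) * (real r + real s) / 2"
    by (simp only: of_nat_add tri of_nat_1) (simp add: field_simps)
  also have "\<dots> \<le> 2 * (real r + real s)\<^sup>2"
  proof -
    have "real s \<le> (real s)\<^sup>2" using assms(3) by (simp add: power2_eq_square)
    moreover have "0 \<le> (real r - real s)\<^sup>2" "0 \<le> real r" "0 \<le> (real s)\<^sup>2" by simp_all
    ultimately show ?thesis by (simp add: power2_eq_square algebra_simps)
  qed
  also have "\<dots> = real (2 * (r + s)\<^sup>2)" by simp
  finally have "(\<Sum>t<r. 2 * (t + 2 * s)) + \<Sum>{..<r + 1 + s} \<le> 2 * (r + s)\<^sup>2"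
    by (simp only: of_nat_le_iff)
  then show ?thesis using r by simp
qed

section \<open>Edges of polytopes in standard form\<close>

definition supp :: "real ^ 'c \<Rightarrow> 'c set" where
  "supp x = {e. x $ e \<noteq> 0}"

lemma supp_diff: "supp (x - y) \<subseteq> supp x \<union> supp y"
  by (auto simp: supp_def)

lemma supp_axis_diff:
  "supp (axis a 1 + axis b 1 - axis e 1 - axis f 1 :: real ^ 'c) \<subseteq> {a, b, e, f}"
  unfolding supp_def by (rule subsetI, rule ccontr) (simp add: axis_def)

text \<open>The feasible set of a linear program in standard form: \<open>N\<close> is the kernel of
  the constraints and \<open>x0\<close> any solution of them. \<open>pointed\<close> makes every ray
  in a nonzero direction of \<open>N\<close> leave the orthant, so that a move along an edge always
  ends in a vertex.\<close>

locale std_polytope =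
  fixes N :: "(real ^ 'c::finite) set" and P :: "(real ^ 'c) set" and x0 :: "real ^ 'c"
  assumes N: "subspace N"
    and pointed: "d \<in> N \<Longrightarrow> (\<And>e. 0 \<le> d $ e) \<Longrightarrow> d = 0"
    and P: "P = {x. (\<forall>e. 0 \<le> x $ e) \<and> x - x0 \<in> N}"
begin

text \<open>Linear independence of the columns indexed by \<open>S\<close> of a constraint matrix
  with kernel \<open>N\<close>, stated without choosing a matrix.\<close>

definition indep :: "'c set \<Rightarrow> bool" where
  "indep S \<longleftrightarrow> (\<forall>d\<in>N. supp d \<subseteq> S \<longrightarrow> d = 0)"

lemma indepD: "indep S \<Longrightarrow> d \<in> N \<Longrightarrow> supp d \<subseteq> S \<Longrightarrow> d = 0"
  by (auto simp: indep_def)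

lemma indep_mono: "indep T \<Longrightarrow> S \<subseteq> T \<Longrightarrow> indep S"
  unfolding indep_def by (meson order_trans)

lemma nonneg: "x \<in> P \<Longrightarrow> 0 \<le> x $ e"
  by (simp add: P)

lemma diff_in_N: "x \<in> P \<Longrightarrow> y \<in> P \<Longrightarrow> x - y \<in> N"
  using subspace_diff[OF N, of "x - x0" "y - x0"] by (simp add: P)

lemma add_in_P: "x \<in> P \<Longrightarrow> d \<in> N \<Longrightarrow> (\<And>e. 0 \<le> x $ e + d $ e) \<Longrightarrow> x + d \<in> P"
  using subspace_add[OF N, of "x - x0" d] by (simp add: P algebra_simps)

text \<open>A zero coordinate of a combination of nonnegative numbers with positive weights forces
  both numbers to be zero.\<close>

lemma supp_segment:
  assumes "a \<in> P" "b \<in> P" "x \<in> open_segment a b"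
  shows "supp a \<subseteq> supp x" "supp b \<subseteq> supp x"
proof -
  obtain t where t: "0 < t" "t < 1" "x = (1 - t) *\<^sub>R a + t *\<^sub>R b"
    using assms(3) by (auto simp: in_segment)
  have z: "a $ e = 0 \<and> b $ e = 0" if "x $ e = 0" for e
  proof -
    have "(1 - t) * a $ e + t * b $ e = 0" using that t(3) by simp
    moreover have "0 \<le> (1 - t) * a $ e" "0 \<le> t * b $ e"
      using t assms nonneg by (auto intro!: mult_nonneg_nonneg)
    ultimately have "(1 - t) * a $ e = 0" "t * b $ e = 0" by linarith+
    then show ?thesis using t by auto
  qed
  show "supp a \<subseteq> supp x" "supp b \<subseteq> supp x" using z by (auto simp: supp_def)
qed

lemma small_perturbation:
  fixes x d :: "real ^ 'c"
  assumes "\<And>e. 0 \<le> x $ e" "supp d \<subseteq> supp x"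
  obtains \<epsilon> where "\<epsilon> > 0" "\<And>e. \<bar>\<epsilon> * d $ e\<bar> \<le> x $ e"
proof -
  define M where "M = Max (insert 1 ((\<lambda>e. \<bar>d $ e\<bar> / x $ e) ` supp x))"
  have M: "\<bar>d $ e\<bar> / x $ e \<le> M" if "e \<in> supp x" for e
    unfolding M_def using that by (intro Max_ge) auto
  have M1: "1 \<le> M" unfolding M_def by (intro Max_ge) auto
  have "\<bar>1 / M * d $ e\<bar> \<le> x $ e" for e
  proof (cases "e \<in> supp x")
    case True
    then have "x $ e > 0" using assms(1)[of e] by (auto simp: supp_def)
    then show ?thesis using M[OF True] M1 by (simp add: field_simps abs_mult)
  next
    case False
    then have "d $ e = 0" using assms(2) by (auto simp: supp_def)
    then show ?thesis using assms(1) by simp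
  qed
  then show thesis using that[of "1 / M"] M1 by simp
qed

text \<open>A kernel vector inside the support allows moving a little in both directions; conversely
  the ends of a segment through \<open>x\<close> have supports inside \<open>supp x\<close>, so
  their difference is such a vector.\<close>

lemma extreme_point_iff: "x extreme_point_of P \<longleftrightarrow> x \<in> P \<and> indep (supp x)"
proof
  assume x: "x extreme_point_of P"
  then have xP: "x \<in> P" by (simp add: extreme_point_of_def)
  have "d = 0" if d: "d \<in> N" "supp d \<subseteq> supp x" for d
  proof (rule ccontr)
    assume "d \<noteq> 0"
    obtain \<epsilon> where \<epsilon>: "\<epsilon> > 0" "\<And>e. \<bar>\<epsilon> * d $ e\<bar> \<le> x $ e"
      using small_perturbation[of x d] nonneg[OF xP] d(2) by blast
    have "x + c *\<^sub>R d \<in> P" if "\<bar>c\<bar> = \<epsilon>" for c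
    proof (rule add_in_P[OF xP])
      show "c *\<^sub>R d \<in> N" using d(1) N by (simp add: subspace_scale)
      show "0 \<le> x $ e + (c *\<^sub>R d) $ e" for e
        using \<epsilon>(2)[of e] that by (auto simp: abs_mult abs_le_iff abs_if split: if_splits)
    qed
    from this[of \<epsilon>] this[of "- \<epsilon>"]
    have "x + \<epsilon> *\<^sub>R d \<in> P" "x + (- \<epsilon>) *\<^sub>R d \<in> P" using \<epsilon>(1) by simp_all
    moreover have "x \<in> open_segment (x + \<epsilon> *\<^sub>R d) (x + (- \<epsilon>) *\<^sub>R d)"
      unfolding in_segment
    proof (intro conjI exI[of _ "1/2::real"])
      show "x + \<epsilon> *\<^sub>R d \<noteq> x + (- \<epsilon>) *\<^sub>R d"
        using \<open>d \<noteq> 0\<close> \<epsilon>(1) by (auto simp: vec_eq_iff eq_neg_iff_add_eq_0)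
      show "x = (1 - 1/2) *\<^sub>R (x + \<epsilon> *\<^sub>R d) + (1/2) *\<^sub>R (x + (- \<epsilon>) *\<^sub>R d)"
        by (auto simp: vec_eq_iff algebra_simps)
    qed auto
    ultimately show False using x by (auto simp: extreme_point_of_def)
  qed
  then show "x \<in> P \<and> indep (supp x)" using xP by (auto simp: indep_def)
next
  assume x: "x \<in> P \<and> indep (supp x)"
  show "x extreme_point_of P"
    unfolding extreme_point_of_def
  proof (intro conjI ballI notI)
    fix a b assume ab: "a \<in> P" "b \<in> P" "x \<in> open_segment a b"
    have "supp (a - b) \<subseteq> supp x"
      using supp_segment[OF ab] supp_diff[of a b] by blast
    then have "a - b = 0" using x indepD diff_in_N ab by blast
    then show False using ab(3) by simp
  qed (use x in auto)
qed

lemma convex_P: "convex P"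
proof (rule convexI)
  fix a b and u v :: real
  assume ab: "a \<in> P" "b \<in> P" and uv: "0 \<le> u" "0 \<le> v" "u + v = 1"
  have "u *\<^sub>R (a - x0) + v *\<^sub>R (b - x0) \<in> N"
    using ab by (intro subspace_add subspace_scale N) (auto simp: P)
  moreover have "u *\<^sub>R (a - x0) + v *\<^sub>R (b - x0) = u *\<^sub>R a + v *\<^sub>R b - x0"
    using uv(3) by (simp add: algebra_simps flip: scaleR_add_left)
  ultimately show "u *\<^sub>R a + v *\<^sub>R b \<in> P"
    using ab uv by (auto simp: P)
qed

text \<open>The points supported in \<open>supp x \<union> supp y\<close> form a face;
  \<open>line\<close> confines it to the line through \<open>x\<close> and \<open>y\<close>, which
  makes it an edge.\<close>

lemma adjacentI:
  assumes x: "x extreme_point_of P" and y: "y extreme_point_of P" and "x \<noteq> y"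
    and line: "\<And>d. d \<in> N \<Longrightarrow> supp d \<subseteq> supp x \<union> supp y \<Longrightarrow> \<exists>c. d = c *\<^sub>R (y - x)"
  shows "(x, y) \<in> parcs (polytope_graph P)"
proof -
  define F where "F = {z \<in> P. supp z \<subseteq> supp x \<union> supp y}"
  have xy: "x \<in> P" "y \<in> P" using x y by (auto simp: extreme_point_of_def)
  have "convex F"
  proof (rule convexI)
    fix a b and u v :: real
    assume ab: "a \<in> F" "b \<in> F" and uv: "0 \<le> u" "0 \<le> v" "u + v = 1"
    have "u *\<^sub>R a + v *\<^sub>R b \<in> P"
      using ab uv convex_P by (auto simp: F_def convex_def)
    moreover have "supp (u *\<^sub>R a + v *\<^sub>R b) \<subseteq> supp a \<union> supp b" by (auto simp: supp_def)
    ultimately show "u *\<^sub>R a + v *\<^sub>R b \<in> F" using ab by (auto simp: F_def)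
  qed
  then have "F face_of P"
    unfolding face_of_def
  proof (intro conjI ballI impI)
    show "F \<subseteq> P" by (auto simp: F_def)
    fix a b z assume "a \<in> P" "b \<in> P" "z \<in> F" "z \<in> open_segment a b"
    then show "a \<in> F" "b \<in> F" using supp_segment[of a b z] unfolding F_def by blast+
  qed
  moreover have "aff_dim F = 1"
  proof -
    have "F \<subseteq> affine hull {x, y}"
    proof
      fix z assume z: "z \<in> F"
      have "supp (z - x) \<subseteq> supp x \<union> supp y"
        using z supp_diff[of z x] by (auto simp: F_def)
      then obtain c where "z - x = c *\<^sub>R (y - x)"
        using line diff_in_N z xy by (fastforce simp: F_def)
      then have "z = (1 - c) *\<^sub>R x + c *\<^sub>R y" by (simp add: algebra_simps)
      then show "z \<in> affine hull {x, y}" unfolding affine_hull_2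
        by (intro CollectI exI[of _ "1 - c"] exI[of _ c]) simp
    qed
    then have "aff_dim F \<le> aff_dim {x, y}"
      by (metis aff_dim_affine_hull aff_dim_subset)
    moreover have "aff_dim {x, y} \<le> aff_dim F"
      using xy by (intro aff_dim_subset) (auto simp: F_def)
    ultimately show ?thesis using \<open>x \<noteq> y\<close> by (simp add: aff_dim_2)
  qed
  ultimately have "F edge_of P" by (simp add: edge_of_def)
  moreover have "x \<in> F" "y \<in> F" using xy by (auto simp: F_def)
  ultimately show ?thesis using x y \<open>x \<noteq> y\<close> by (auto simp: polytope_graph_def)
qed

section \<open>Pivot steps along edges\<close>

text \<open>The ratio test of the simplex method. \<open>feasible\<close> makes the step length
  positive, also at degenerate vertices; \<open>line\<close> says that the cells involved carry one
  circuit up to scaling, which makes the end a vertex and the step an edge.\<close>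

lemma edge_step:
  assumes x: "x extreme_point_of P" and d: "d \<in> N" "d \<noteq> 0"
    and feasible: "\<And>e. x $ e = 0 \<Longrightarrow> 0 \<le> d $ e"
    and line: "\<And>d'. d' \<in> N \<Longrightarrow> supp d' \<subseteq> supp x \<union> supp d \<Longrightarrow> \<exists>c. d' = c *\<^sub>R d"
  obtains y where "y extreme_point_of P" "near P 1 x y"
    "supp y \<subseteq> supp x \<union> supp d"
    "\<And>e. 0 < d $ e \<Longrightarrow> e \<in> supp y" "\<And>e. 0 \<le> d $ e \<Longrightarrow> e \<in> supp x \<Longrightarrow> e \<in> supp y"
    "\<exists>e. d $ e < 0 \<and> e \<notin> supp y"
proof -
  have xP: "x \<in> P" using x by (simp add: extreme_point_of_def)
  define D where "D = {e. d $ e < 0}"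
  have "D \<noteq> {}" using pointed[OF d(1)] d(2) by (auto simp: D_def not_less)
  \<comment> \<open>The largest step that keeps all coordinates nonnegative; a minimizing cell
    \<open>e0\<close> drops out of the support.\<close>
  define t where "t = Min ((\<lambda>e. x $ e / - d $ e) ` D)"
  have "t \<in> (\<lambda>e. x $ e / - d $ e) ` D"
    unfolding t_def using \<open>D \<noteq> {}\<close> by (intro Min_in) auto
  then obtain e0 where e0: "e0 \<in> D" "t = x $ e0 / - d $ e0" by blast
  have t_le: "t \<le> x $ e / - d $ e" if "e \<in> D" for e
    unfolding t_def using that by (intro Min_le) auto
  have "x $ e0 > 0"
    using feasible[of e0] nonneg[OF xP, of e0] e0(1) unfolding D_def by force
  then have t: "t > 0" using e0 by (auto simp: D_def divide_pos_neg intro!: divide_pos_pos)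
  define y where "y = x + t *\<^sub>R d"
  have y_nth: "y $ e = x $ e + t * d $ e" for e by (simp add: y_def)
  have ye0: "y $ e0 = 0" using e0 by (simp add: y_nth D_def)
  have "y \<in> P"
    unfolding y_def
  proof (rule add_in_P[OF xP])
    show "t *\<^sub>R d \<in> N" using d(1) N by (simp add: subspace_scale)
    show "0 \<le> x $ e + (t *\<^sub>R d) $ e" for e
    proof (cases "e \<in> D")
      case True
      then show ?thesis using t_le[OF True] by (simp add: D_def field_simps)
    next
      case False
      then show ?thesis using t nonneg[OF xP, of e] by (simp add: D_def)
    qed
  qed
  have sy: "supp y \<subseteq> supp x \<union> supp d" by (auto simp: supp_def y_nth)
  have "indep (supp y)"
    unfolding indep_def
  proof (intro ballI impI)
    fix d' assume d': "d' \<in> N" "supp d' \<subseteq> supp y"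
    then obtain c where c: "d' = c *\<^sub>R d" using line sy by blast
    have "d' $ e0 = 0" using d'(2) ye0 by (auto simp: supp_def)
    then show "d' = 0" using c e0(1) by (simp add: D_def)
  qed
  then have y: "y extreme_point_of P" using \<open>y \<in> P\<close> by (simp add: extreme_point_iff)
  have "(x, y) \<in> parcs (polytope_graph P)"
  proof (rule adjacentI[OF x y])
    show "x \<noteq> y" using t d(2) by (simp add: y_def)
    fix d' assume "d' \<in> N" "supp d' \<subseteq> supp x \<union> supp y"
    then obtain c where "d' = c *\<^sub>R d" using line sy by blast
    then show "\<exists>c. d' = c *\<^sub>R (y - x)"
      using t by (intro exI[of _ "c / t"]) (simp add: y_def)
  qed
  moreover have "e \<in> supp y" if "0 < d $ e" for e
    using less_imp_neq[OF add_nonneg_pos[OF nonneg[OF xP] mult_pos_pos[OF t that]]]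
    by (auto simp: supp_def y_nth)
  moreover have "e \<in> supp y" if "0 \<le> d $ e" "e \<in> supp x" for e
  proof -
    have "0 < x $ e" using that(2) nonneg[OF xP, of e] by (simp add: supp_def less_le)
    then have "0 < y $ e" using that(1) t by (simp add: y_nth add_pos_nonneg)
    then show ?thesis by (simp add: supp_def)
  qed
  ultimately show thesis
    using that[OF y near_adj sy] e0(1) ye0 by (auto simp: D_def supp_def)
qed

text \<open>An independent support together with one new cell \<open>q\<close> carries at most one
  circuit up to scaling, and that circuit contains \<open>q\<close>. Which cell leaves is not
  controlled.\<close>

lemma pivot:
  assumes x: "x extreme_point_of P" and q: "q \<notin> supp x" and dep: "\<not> indep (insert q (supp x))"
  obtains y where "y extreme_point_of P" "near P 1 x y" "supp y \<subseteq> insert q (supp x)" "q \<in> supp y"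
proof -
  have ind: "indep (supp x)" using x extreme_point_iff by blast
  obtain d' where d': "d' \<in> N" "supp d' \<subseteq> insert q (supp x)" "d' \<noteq> 0"
    using dep by (auto simp: indep_def)
  have "d' $ q \<noteq> 0"
  proof
    assume "d' $ q = 0"
    then have "supp d' \<subseteq> supp x" using d'(2) by (auto simp: supp_def)
    then show False using ind indepD d' by blast
  qed
  define d where "d = (1 / d' $ q) *\<^sub>R d'"
  have d: "d \<in> N" "supp d \<subseteq> insert q (supp x)" "d $ q = 1"
    using d' \<open>d' $ q \<noteq> 0\<close> N by (auto simp: d_def subspace_scale supp_def)
  obtain y where "y extreme_point_of P" "near P 1 x y" "supp y \<subseteq> supp x \<union> supp d"
    "\<And>e. 0 < d $ e \<Longrightarrow> e \<in> supp y"
  proof (rule edge_step[OF x d(1)])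
    show "d \<noteq> 0" using d(3) by auto
    show "0 \<le> d $ e" if "x $ e = 0" for e
    proof (cases "e = q")
      case False
      then have "e \<notin> supp d" using that d(2) by (auto simp: supp_def)
      then show ?thesis by (simp add: supp_def)
    qed (simp add: d(3))
    show "\<exists>c. d' = c *\<^sub>R d" if "d' \<in> N" "supp d' \<subseteq> supp x \<union> supp d" for d'
    proof -
      have "supp (d' - d' $ q *\<^sub>R d) \<subseteq> supp x"
      proof
        fix a assume a: "a \<in> supp (d' - d' $ q *\<^sub>R d)"
        then have "a \<noteq> q" using d(3) by (auto simp: supp_def)
        moreover have "a \<in> supp x \<union> supp d" using a that(2) by (auto simp: supp_def)
        ultimately show "a \<in> supp x" using d(2) by blast
      qed
      then have "d' - d' $ q *\<^sub>R d = 0"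
        using that(1) d(1) N by (intro indepD[OF ind]) (auto intro: subspace_diff subspace_scale)
      then show ?thesis by auto
    qed
  qed blast
  note y = this
  show thesis
  proof (rule that[OF y(1,2)])
    show "supp y \<subseteq> insert q (supp x)" using y(3) d(2) by blast
    show "q \<in> supp y" using y(4)[of q] d(3) by simp
  qed
qed

text \<open>Here the circuit is prescribed: only \<open>e\<close> and \<open>f\<close> decrease, so
  no other cell can leave. Independence of \<open>insert q (supp x)\<close> keeps \<open>z\<close>
  out of that set, since otherwise the circuit would lie in it; hence cancelling coordinate
  \<open>z\<close> shows that there is only one circuit up to scaling.\<close>

lemma exchange:
  assumes x: "x extreme_point_of P"
    and ef: "e \<in> supp x" "f \<in> supp x" and qz: "q \<notin> {e, f}" "z \<notin> {q, e, f}"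
    and circ: "axis q 1 + axis z 1 - axis e 1 - axis f 1 \<in> N"
    and ind: "indep (insert q (supp x))"
  obtains y where "y extreme_point_of P" "near P 1 x y" "supp y \<subseteq> {q, z} \<union> supp x"
    "supp x - {e, f} \<subseteq> supp y" "q \<in> supp y" "e \<notin> supp y \<or> f \<notin> supp y"
proof -
  define d :: "real ^ 'c" where "d = axis q 1 + axis z 1 - axis e 1 - axis f 1"
  have dN: "d \<in> N" using circ by (simp add: d_def)
  have dz: "d $ z = 1" and dq: "d $ q = 1" using qz by (auto simp: d_def axis_def)
  have sd: "supp d \<subseteq> {q, z, e, f}" unfolding d_def by (rule supp_axis_diff)
  have neg: "a = e \<or> a = f" if "d $ a < 0" for a
    using that by (auto simp: d_def axis_def split: if_splits)
  have zx: "z \<notin> insert q (supp x)"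
  proof
    assume "z \<in> insert q (supp x)"
    then have "supp d \<subseteq> insert q (supp x)" using sd ef by auto
    then have "d = 0" using ind indepD dN by blast
    then show False using dz by simp
  qed
  obtain y where "y extreme_point_of P" "near P 1 x y" "supp y \<subseteq> supp x \<union> supp d"
    "\<And>e. 0 < d $ e \<Longrightarrow> e \<in> supp y" "\<And>e. 0 \<le> d $ e \<Longrightarrow> e \<in> supp x \<Longrightarrow> e \<in> supp y"
    "\<exists>e. d $ e < 0 \<and> e \<notin> supp y"
  proof (rule edge_step[OF x dN])
    show "d \<noteq> 0" using dz by auto
    show "0 \<le> d $ a" if "x $ a = 0" for a
      using that neg[of a] ef by (force simp: supp_def not_less)
    show "\<exists>c. d' = c *\<^sub>R d" if "d' \<in> N" "supp d' \<subseteq> supp x \<union> supp d" for d'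
    proof -
      have "supp (d' - d' $ z *\<^sub>R d) \<subseteq> insert q (supp x)"
      proof
        fix a assume a: "a \<in> supp (d' - d' $ z *\<^sub>R d)"
        then have "a \<noteq> z" using dz by (auto simp: supp_def)
        moreover have "a \<in> supp x \<union> supp d" using a that(2) by (auto simp: supp_def)
        ultimately show "a \<in> insert q (supp x)" using sd ef by blast
      qed
      then have "d' - d' $ z *\<^sub>R d = 0"
        using that(1) dN N by (intro indepD[OF ind]) (auto intro: subspace_diff subspace_scale)
      then show ?thesis by auto
    qed
  qed blast
  note y = this
  show thesis
  proof (rule that[OF y(1,2)])
    show "supp y \<subseteq> {q, z} \<union> supp x" using y(3) sd ef by blast
    show "supp x - {e, f} \<subseteq> supp y" using y(5) neg by (metis DiffE insert_iff not_less subsetI)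
    show "q \<in> supp y" using y(4) dq by simp
    show "e \<notin> supp y \<or> f \<notin> supp y" using y(6) neg by blast
  qed
qed

text \<open>
  Either the cells in \<open>I\<close> or those in \<open>J\<close> can be removed from the support. An exchange at \<open>e\<close>, \<open>f\<close>
  follows an edge once \<open>q e\<close> can be added to the support without creating a circuit; otherwise
  \<open>q e\<close> is first pivoted in. Such a pivot may remove any cell, but it happens only while no relevant
  \<open>q e\<close> is present, and exchanges never remove a \<open>q e\<close>: hence the last summand of the potential.
\<close>

lemma clear_cross:
  assumes "x extreme_point_of P" "supp x \<subseteq> E"
    and q: "\<And>e. e \<in> I \<Longrightarrow> q e \<in> E - I - J"
    and z: "\<And>e f. e \<in> I \<Longrightarrow> f \<in> J \<Longrightarrow> z e f \<in> E - I - J \<and> z e f \<noteq> q e"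
    and circ: "\<And>e f. e \<in> I \<Longrightarrow> f \<in> J \<Longrightarrow>
      axis (q e) 1 + axis (z e f) 1 - axis e 1 - axis f 1 \<in> N"
  shows "\<exists>y. y extreme_point_of P \<and> supp y \<subseteq> E \<and> (I \<inter> supp y = {} \<or> J \<inter> supp y = {}) \<and>
    near P (card (I \<inter> supp x) + card (J \<inter> supp x) + card (q ` (I \<inter> supp x) - supp x) - 1) x y"
  using assms(1,2)
proof (induction "card (I \<inter> supp x) + card (J \<inter> supp x) + card (q ` (I \<inter> supp x) - supp x)"
    arbitrary: x rule: less_induct)
  case less
  let ?\<Psi> = "\<lambda>x. card (I \<inter> supp x) + card (J \<inter> supp x) + card (q ` (I \<inter> supp x) - supp x)"
  have x: "x extreme_point_of P" "supp x \<subseteq> E" by fact+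
  show ?case
  proof (cases "I \<inter> supp x = {} \<or> J \<inter> supp x = {}")
    case True
    then show ?thesis using x near_refl by blast
  next
    case False
    then obtain f where f: "f \<in> J" "f \<in> supp x" by blast
    have "\<exists>y. y extreme_point_of P \<and> supp y \<subseteq> E \<and> near P 1 x y \<and> ?\<Psi> y < ?\<Psi> x"
    proof (cases "\<exists>e \<in> I \<inter> supp x. indep (insert (q e) (supp x))")
      case True
      then obtain e where e: "e \<in> I" "e \<in> supp x" "indep (insert (q e) (supp x))" by blast
      obtain y where y: "y extreme_point_of P" "near P 1 x y"
        "supp y \<subseteq> {q e, z e f} \<union> supp x" "supp x - {e, f} \<subseteq> supp y" "q e \<in> supp y"
        "e \<notin> supp y \<or> f \<notin> supp y"
      proof (rule exchange[OF x(1) e(2) f(2) _ _ circ[OF e(1) f(1)] e(3)])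
        show "q e \<notin> {e, f}" using q[OF e(1)] e(1) f(1) by auto
        show "z e f \<notin> {q e, e, f}" using z[OF e(1) f(1)] e(1) f(1) by auto
      qed
      have I: "I \<inter> supp y \<subseteq> I \<inter> supp x" and J: "J \<inter> supp y \<subseteq> J \<inter> supp x"
        using y(3) q[OF e(1)] z[OF e(1) f(1)] by auto
      \<comment> \<open>The values of \<open>q\<close> lie outside \<open>I\<close> and
        \<open>J\<close>, so the exchange, which removes at most \<open>e\<close> and
        \<open>f\<close>, loses none of them.\<close>
      have Q: "q ` (I \<inter> supp y) - supp y \<subseteq> q ` (I \<inter> supp x) - supp x"
        using I y(4) q e(1) f(1) by blast
      have "I \<inter> supp y \<subset> I \<inter> supp x \<or> J \<inter> supp y \<subset> J \<inter> supp x"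
        using I J y(6) e f by blast
      then have "card (I \<inter> supp y) + card (J \<inter> supp y) < card (I \<inter> supp x) + card (J \<inter> supp x)"
      proof
        assume "I \<inter> supp y \<subset> I \<inter> supp x"
        then have "card (I \<inter> supp y) < card (I \<inter> supp x)" by (intro psubset_card_mono) auto
        then show ?thesis using card_mono[OF finite J] by linarith
      next
        assume "J \<inter> supp y \<subset> J \<inter> supp x"
        then have "card (J \<inter> supp y) < card (J \<inter> supp x)" by (intro psubset_card_mono) auto
        then show ?thesis using card_mono[OF finite I] by linarith
      qed
      then have "?\<Psi> y < ?\<Psi> x" using card_mono[OF finite Q] by linarith
      moreover have "supp y \<subseteq> E" using y(3) x(2) q[OF e(1)] z[OF e(1) f(1)] by auto
      ultimately show ?thesis using y by blast
    next
      case dep: False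
      obtain e where e: "e \<in> I" "e \<in> supp x" using False by blast
      \<comment> \<open>If \<open>q a\<close> were present, inserting it would change nothing, and
        the support of a vertex is independent, against \<open>dep\<close>.\<close>
      have q_notin: "q a \<notin> supp x" if "a \<in> I" "a \<in> supp x" for a
        proof
        assume "q a \<in> supp x"
        then have "indep (insert (q a) (supp x))" using x(1) by (simp add: extreme_point_iff insert_absorb)
        then show False using dep that by blast
      qed
      obtain y where y: "y extreme_point_of P" "near P 1 x y"
        "supp y \<subseteq> insert (q e) (supp x)" "q e \<in> supp y"
        using pivot[OF x(1) q_notin[OF e]] dep e by blast
      have I: "I \<inter> supp y \<subseteq> I \<inter> supp x" and J: "J \<inter> supp y \<subseteq> J \<inter> supp x"
        using y(3) q[OF e(1)] by auto
      \<comment> \<open>None of the targets of \<open>I \<inter> supp x\<close> is present before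
        the pivot, so dropping cells cannot enlarge this set, while \<open>q e\<close> leaves
        it.\<close>
      have Q: "q ` (I \<inter> supp y) - supp y \<subset> q ` (I \<inter> supp x) - supp x"
        using I y(4) q_notin e by blast
      have "?\<Psi> y < ?\<Psi> x"
        using card_mono[OF finite I] card_mono[OF finite J] psubset_card_mono[OF finite Q]
        by linarith
      moreover have "supp y \<subseteq> E" using y(3) x(2) q[OF e(1)] by auto
      ultimately show ?thesis using y by blast
    qed
    then obtain y where y: "y extreme_point_of P" "supp y \<subseteq> E" "near P 1 x y" "?\<Psi> y < ?\<Psi> x"
      by blast
    then obtain y' where y': "y' extreme_point_of P" "supp y' \<subseteq> E"
      "I \<inter> supp y' = {} \<or> J \<inter> supp y' = {}" "near P (?\<Psi> y - 1) y y'"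
      using less.hyps[OF y(4,1,2)] by blast
    \<comment> \<open>Both summands are positive, so the potential is at least 2 here; this pays for
      the truncated \<open>- 1\<close> when \<open>?\<Psi> y\<close> is 0.\<close>
    have "card (I \<inter> supp x) \<noteq> 0" "card (J \<inter> supp x) \<noteq> 0" using False by auto
    then have "1 + (?\<Psi> y - 1) \<le> ?\<Psi> x - 1" using y(4) by linarith
    then have "near P (?\<Psi> x - 1) x y'" using near_mono[OF near_trans[OF y(3) y'(4)]] by blast
    then show ?thesis using y' by blast
  qed
qed

section \<open>Rank bound and comparison of two points\<close>

text \<open>A rank count: with more cells in \<open>S\<close> than equations in \<open>T\<close>,
  the homogeneous system restricted to \<open>S\<close> has a nonzero solution, which
  \<open>ker\<close> places in \<open>N\<close>.\<close>

lemma card_indep_le: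
  assumes S: "indep S" and "finite T"
    and ker: "\<And>d. supp d \<subseteq> S \<Longrightarrow> (\<And>t. t \<in> T \<Longrightarrow> (\<Sum>e\<in>g t. d $ e) = 0) \<Longrightarrow> d \<in> N"
  shows "card S \<le> card T"
proof (rule ccontr)
  assume less: "\<not> card S \<le> card T"
  define B where "B = (\<lambda>e. axis e 1 :: real ^ 'c) ` S"
  \<comment> \<open>The row of equation \<open>t\<close> restricted to the columns in
    \<open>S\<close>; a vector of \<open>span B\<close> orthogonal to all rows solves the
    system.\<close>
  define r where "r t = (\<Sum>e\<in>g t \<inter> S. axis e 1 :: real ^ 'c)" for t
  have "inj_on (\<lambda>e. axis e 1 :: real ^ 'c) S" by (auto simp: inj_on_def axis_eq_axis)
  then have cB: "card B = card S" by (simp add: B_def card_image)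
  have "B \<subseteq> Basis" by (auto simp: B_def Basis_vec_def)
  then have "independent B" using independent_Basis independent_mono by blast
  then have dB: "dim (span B) = card S" using cB by (simp add: dim_eq_card_independent)
  have "r ` T \<subseteq> span B" by (auto simp: r_def B_def intro!: span_sum intro: span_base)
  then have sub: "span (r ` T) \<subseteq> span B" by (simp add: span_minimal)
  have "dim (span (r ` T)) \<le> card (r ` T)" using \<open>finite T\<close> by (simp add: dim_le_card')
  also have "\<dots> \<le> card T" using \<open>finite T\<close> by (rule card_image_le)
  finally have dT: "dim (span (r ` T)) \<le> card T" .
  have "span (r ` T) \<noteq> span B"
  proof
    assume "span (r ` T) = span B"
    then show False using dT less unfolding dB by (simp only: dB)
  qed
  then have "span (r ` T) \<subset> span B" using sub by blast
  then obtain d where d: "d \<noteq> 0" "d \<in> span B" "\<And>y. y \<in> span (r ` T) \<Longrightarrow> orthogonal d y"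
    using orthogonal_to_subspace_exists_gen by blast
  have "span B \<subseteq> {d. supp d \<subseteq> S}"
  proof (rule span_minimal)
    show "B \<subseteq> {d. supp d \<subseteq> S}" by (auto simp: B_def supp_def axis_def split: if_splits)
    show "subspace {d :: real ^ 'c. supp d \<subseteq> S}"
      unfolding subspace_def
    proof (intro conjI ballI allI)
      fix a b :: "real ^ 'c" assume "a \<in> {d. supp d \<subseteq> S}" "b \<in> {d. supp d \<subseteq> S}"
      moreover have "supp (a + b) \<subseteq> supp a \<union> supp b" by (auto simp: supp_def)
      ultimately show "a + b \<in> {d. supp d \<subseteq> S}" by blast
    qed (auto simp: supp_def)
  qed
  then have sd: "supp d \<subseteq> S" using d(2) by auto
  have "(\<Sum>e\<in>g t. d $ e) = 0" if "t \<in> T" for t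
  proof -
    have "0 = d \<bullet> r t" using d(3)[of "r t"] that by (simp add: orthogonal_def span_base)
    also have "\<dots> = (\<Sum>e\<in>g t \<inter> S. d $ e)" by (simp add: r_def inner_sum_right inner_axis)
    also have "\<dots> = (\<Sum>e\<in>g t. d $ e)" using sd by (intro sum.mono_neutral_left) (auto simp: supp_def)
    finally show ?thesis by simp
  qed
  then have "d = 0" using ker[OF sd] indepD[OF S _ sd] by blast
  then show False using d(1) by simp
qed

text \<open>The difference of the sums over \<open>I\<close> and over \<open>J\<close> is the same
  for \<open>x\<close> and \<open>y\<close>. Each point has one of its two sums equal to 0, so the
  sign of this difference tells which set is empty for both; if it is 0, both sets are.\<close>

lemma cross_empty_same:
  assumes xy: "x \<in> P" "y \<in> P" and disj: "Q \<inter> I = {}" "Q \<inter> J = {}"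
    and eq: "(\<Sum>e\<in>Q \<union> I. (x - y) $ e) = 0" "(\<Sum>e\<in>Q \<union> J. (x - y) $ e) = 0"
    and x: "I \<inter> supp x = {} \<or> J \<inter> supp x = {}" and y: "I \<inter> supp y = {} \<or> J \<inter> supp y = {}"
  shows "I \<inter> (supp x \<union> supp y) = {} \<or> J \<inter> (supp x \<union> supp y) = {}"
proof -
  have zero: "(\<Sum>e\<in>C. w $ e) = 0 \<longleftrightarrow> C \<inter> supp w = {}" if "w \<in> P" for w and C :: "'c set"
    using nonneg[OF that] by (subst sum_nonneg_eq_0_iff) (auto simp: supp_def)
  have ge: "0 \<le> (\<Sum>e\<in>C. w $ e)" if "w \<in> P" for w and C :: "'c set"
    using nonneg[OF that] by (simp add: sum_nonneg)
  have I: "(\<Sum>e\<in>Q. x $ e) + (\<Sum>e\<in>I. x $ e) = (\<Sum>e\<in>Q. y $ e) + (\<Sum>e\<in>I. y $ e)"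
    and J: "(\<Sum>e\<in>Q. x $ e) + (\<Sum>e\<in>J. x $ e) = (\<Sum>e\<in>Q. y $ e) + (\<Sum>e\<in>J. y $ e)"
    using eq disj by (simp_all add: sum.union_disjoint sum_subtractf)
  note ge = ge[OF xy(1), of I] ge[OF xy(1), of J] ge[OF xy(2), of I] ge[OF xy(2), of J]
  from x y show ?thesis
    unfolding Int_Un_distrib Un_empty zero[OF xy(1), symmetric] zero[OF xy(2), symmetric]
    using I J ge by (elim disjE) linarith+
qed

end

section \<open>Margins and supports\<close>

lemma sum_supp_cong:
  fixes d :: "real ^ 'c::finite"
  assumes "C \<inter> supp d = D \<inter> supp d"
  shows "(\<Sum>e\<in>C. d $ e) = (\<Sum>e\<in>D. d $ e)"
proof -
  have "(\<Sum>e\<in>C. d $ e) = (\<Sum>e\<in>C \<inter> supp d. d $ e)" for C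
    by (intro sum.mono_neutral_right) (auto simp: supp_def)
  then show ?thesis using assms by metis
qed

lemma sum_fibres_zero:
  fixes d :: "real ^ 'c::finite"
  assumes "\<And>h. h \<in> g ` C \<Longrightarrow> (\<Sum>e\<in>{e \<in> C. g e = h}. d $ e) = 0"
  shows "(\<Sum>e\<in>C. d $ e) = 0"
  using sum.group[of C "g ` C" g "\<lambda>e. d $ e"] assms by simp

text \<open>One margin of a family is redundant once the total is known; this is the source of the
  \<open>- 1\<close> and \<open>- 2\<close> in the cardinality bounds.\<close>

lemma fibre_zero_of_others:
  fixes d :: "real ^ 'c::finite" and h0 :: "'h::finite"
  assumes "(\<Sum>e\<in>UNIV. d $ e) = 0" "\<And>h. h \<noteq> h0 \<Longrightarrow> (\<Sum>e\<in>{e. g e = h}. d $ e) = 0"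
  shows "(\<Sum>e\<in>{e. g e = h}. d $ e) = 0"
proof -
  have "(\<Sum>e\<in>UNIV. d $ e) = (\<Sum>h\<in>UNIV. \<Sum>e\<in>{e. g e = h}. d $ e)"
    using sum.group[of UNIV "UNIV :: 'h set" g "\<lambda>e. d $ e"] by simp
  also have "\<dots> = (\<Sum>h\<in>{h0}. \<Sum>e\<in>{e. g e = h}. d $ e)"
    using assms(2) by (intro sum.mono_neutral_right) auto
  finally show ?thesis using assms by (cases "h = h0") simp_all
qed

lemma mult_card_le_of_fibres:
  assumes "finite S" "finite H" "g ` S \<subseteq> H" "\<And>h. h \<in> H \<Longrightarrow> m \<le> card {e \<in> S. g e = h}"
  shows "m * card H \<le> card S"
proof -
  have "m * card H = (\<Sum>h\<in>H. m)" by simp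
  also have "\<dots> \<le> (\<Sum>h\<in>H. card {e \<in> S. g e = h})" using assms(4) by (rule sum_mono)
  also have "\<dots> = card S" using sum.group[OF assms(1-3), of "\<lambda>_. 1 :: nat"] by simp
  finally show ?thesis .
qed

definition margin_kernel :: "(real ^ ('p::finite \<times> 'q::finite \<times> 's::finite)) set" where
  "margin_kernel = {d. (\<forall>i. (\<Sum>e | fst e = i. d $ e) = 0) \<and>
     (\<forall>j. (\<Sum>e | fst (snd e) = j. d $ e) = 0) \<and> (\<forall>k. (\<Sum>e | snd (snd e) = k. d $ e) = 0)}"

definition pr :: "'p \<times> 'q \<times> 's \<Rightarrow> 'p \<times> 'q" where
  "pr e = (fst e, fst (snd e))"

text \<open>A cell is read as an entry of a two-way table with row \<open>(i, j)\<close> and column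
  \<open>k\<close>; this is the block with rows \<open>H\<close> and columns
  \<open>K\<close>.\<close>

definition over :: "('p \<times> 'q) set \<Rightarrow> 's set \<Rightarrow> ('p \<times> 'q \<times> 's) set" where
  "over H K = {e. pr e \<in> H \<and> snd (snd e) \<in> K}"

lemma mem_over [simp]: "(i, j, k) \<in> over H K \<longleftrightarrow> (i, j) \<in> H \<and> k \<in> K"
  by (simp add: over_def pr_def)

lemma subspace_margin_kernel: "subspace margin_kernel"
  by (simp add: subspace_def margin_kernel_def sum.distrib flip: sum_distrib_left)

lemma margin_kernel_nonneg:
  assumes "d \<in> margin_kernel" "\<And>e. 0 \<le> d $ e"
  shows "d = 0"
proof -
  have "d $ e = 0" for e
  proof -
    have "(\<Sum>a | fst a = fst e. d $ a) = 0" using assms(1) by (simp add: margin_kernel_def)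
    then have "\<forall>a\<in>{a. fst a = fst e}. d $ a = 0"
      using assms(2) by (subst (asm) sum_nonneg_eq_0_iff) auto
    then show ?thesis by blast
  qed
  then show ?thesis by (simp add: vec_eq_iff)
qed

lemma nested_margins:
  fixes x :: "real ^ ('p::finite \<times> 'q::finite \<times> 's::finite)"
  shows "(\<Sum>j\<in>UNIV. \<Sum>k\<in>UNIV. x $ (i, j, k)) = (\<Sum>e | fst e = i. x $ e)"
    and "(\<Sum>i\<in>UNIV. \<Sum>k\<in>UNIV. x $ (i, j, k)) = (\<Sum>e | fst (snd e) = j. x $ e)"
    and "(\<Sum>i\<in>UNIV. \<Sum>j\<in>UNIV. x $ (i, j, k)) = (\<Sum>e | snd (snd e) = k. x $ e)"
proof -
  show "(\<Sum>j\<in>UNIV. \<Sum>k\<in>UNIV. x $ (i, j, k)) = (\<Sum>e | fst e = i. x $ e)"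
    unfolding sum.cartesian_product
    by (rule sum.reindex_bij_witness[of _ snd "Pair i"]) auto
  show "(\<Sum>i\<in>UNIV. \<Sum>k\<in>UNIV. x $ (i, j, k)) = (\<Sum>e | fst (snd e) = j. x $ e)"
    unfolding sum.cartesian_product
    by (rule sum.reindex_bij_witness[of _ "\<lambda>e. (fst e, snd (snd e))" "\<lambda>(i, k). (i, j, k)"]) auto
  show "(\<Sum>i\<in>UNIV. \<Sum>j\<in>UNIV. x $ (i, j, k)) = (\<Sum>e | snd (snd e) = k. x $ e)"
    unfolding sum.cartesian_product
    by (rule sum.reindex_bij_witness[of _ "\<lambda>e. (fst e, fst (snd e))" "\<lambda>(i, j). (i, j, k)"]) auto
qed

lemma transportation_polytope_eq:
  assumes "x0 \<in> transportation_polytope u v w"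
  shows "transportation_polytope u v w = {x. (\<forall>e. 0 \<le> x $ e) \<and> x - x0 \<in> margin_kernel}"
  using assms unfolding transportation_polytope_def nested_margins margin_kernel_def
  by (auto simp: sum_subtractf)

lemma sum_axis: "(\<Sum>e | Q e. axis c (1::real) $ e) = (if Q c then 1 else 0)" for c :: "'c::finite"
  by (simp add: axis_def)

text \<open>The second indices are swapped while each cell keeps its first and third index, so all
  margins balance; the sums over single pairs need not.\<close>

lemma exchange_mixed:
  "axis (i, j, c) 1 + axis (a, b, c') 1 - axis (i, b, c) 1 - axis (a, j, c') 1 \<in> margin_kernel"
  by (simp add: margin_kernel_def sum.distrib sum_subtractf sum_axis)

text \<open>The third indices are swapped, so the pair sums balance as well: a rectangle circuit of
  the two-way table.\<close>

lemma exchange_last: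
  "axis (i, j, k) 1 + axis (i', j', k') 1 - axis (i, j, k') 1 - axis (i', j', k) 1 \<in> margin_kernel"
  by (simp add: margin_kernel_def sum.distrib sum_subtractf sum_axis)

lemma margin_kernelI_pr:
  fixes d :: "real ^ ('p::finite \<times> 'q::finite \<times> 's::finite)"
  assumes "\<And>h. (\<Sum>e | pr e = h. d $ e) = 0" "\<And>k. (\<Sum>e | snd (snd e) = k. d $ e) = 0"
  shows "d \<in> margin_kernel"
proof -
  have "(\<Sum>e | u (pr e) = i. d $ e) = 0" for u :: "'p \<times> 'q \<Rightarrow> 'i" and i
  proof (rule sum_fibres_zero[of pr])
    fix h assume "h \<in> pr ` {e. u (pr e) = i}"
    then have "{e \<in> {e. u (pr e) = i}. pr e = h} = {e :: 'p \<times> 'q \<times> 's. pr e = h}" by auto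
    then show "(\<Sum>e\<in>{e \<in> {e. u (pr e) = i}. pr e = h}. d $ e) = 0"
      using assms(1) by (simp only:)
  qed
  from this[of fst] this[of snd] show ?thesis
    using assms(2) by (simp add: margin_kernel_def pr_def)
qed

lemma sum_over_rows_zero:
  fixes d :: "real ^ ('p::finite \<times> 'q::finite \<times> 's::finite)"
  assumes "\<And>h. h \<in> H \<Longrightarrow> (\<Sum>e\<in>over {h} K. d $ e) = 0"
  shows "(\<Sum>e\<in>over H K. d $ e) = 0"
proof (rule sum_fibres_zero[of pr])
  fix h assume "h \<in> pr ` over H K"
  then have "h \<in> H" "{e \<in> over H K. pr e = h} = over {h} K" by (auto simp: over_def)
  then show "(\<Sum>e\<in>{e \<in> over H K. pr e = h}. d $ e) = 0" using assms by simp
qed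

section \<open>Cardinality of independent supports\<close>

locale axial = std_polytope margin_kernel P x0
  for P :: "(real ^ ('p::finite \<times> 'q::finite \<times> 's::finite)) set" and x0
begin

lemma card_two_way_le:
  assumes ind: "indep S" and S: "S \<subseteq> over H K" and "K \<noteq> {}"
  shows "card S \<le> card H + card K - 1"
proof -
  obtain k0 where k0: "k0 \<in> K" using \<open>K \<noteq> {}\<close> by blast
  let ?T = "H <+> (K - {k0})"
  define g :: "('p \<times> 'q) + 's \<Rightarrow> ('p \<times> 'q \<times> 's) set"
    where "g = case_sum (\<lambda>h. {e. pr e = h}) (\<lambda>k. {e. snd (snd e) = k})"
  have "card S \<le> card ?T"
  proof (rule card_indep_le[OF ind])
    fix d :: "real ^ ('p \<times> 'q \<times> 's)"
    assume sd: "supp d \<subseteq> S" and zero: "\<And>t. t \<in> ?T \<Longrightarrow> (\<Sum>e\<in>g t. d $ e) = 0"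
    have off: "(\<Sum>e\<in>C. d $ e) = 0" if "C \<inter> over H K = {}" for C
      using sum_supp_cong[of C d "{}"] that sd S by auto
    have row: "(\<Sum>e | pr e = h. d $ e) = 0" for h
    proof (cases "h \<in> H")
      case True
      then show ?thesis using zero[of "Inl h"] by (simp add: g_def InlI)
    qed (intro off, auto simp: over_def)
    have col: "(\<Sum>e | snd (snd e) = k. d $ e) = 0" if "k \<noteq> k0" for k
    proof (cases "k \<in> K")
      case True
      then show ?thesis using zero[of "Inr k"] that by (simp add: g_def InrI)
    qed (intro off, auto simp: over_def)
    have "(\<Sum>e\<in>UNIV. d $ e) = 0" by (rule sum_fibres_zero[of pr]) (simp add: row)
    then have "(\<Sum>e | snd (snd e) = k. d $ e) = 0" for k
      using col by (rule fibre_zero_of_others)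
    then show "d \<in> margin_kernel" using row by (intro margin_kernelI_pr)
  qed simp
  also have "card ?T = card H + card K - 1"
    using k0 card_gt_0_iff[of K] by (auto simp: card_Plus)
  finally show ?thesis .
qed

text \<open>As in the two-way count, but three families of margins share one total, so one margin of
  the second and one of the third family is dropped.\<close>

lemma card_box_le:
  assumes ind: "indep S" and S: "S \<subseteq> over (A \<times> B) UNIV" and "B \<noteq> {}"
  shows "card S \<le> card A + card B + CARD('s) - 2"
proof -
  obtain j0 where j0: "j0 \<in> B" using \<open>B \<noteq> {}\<close> by blast
  obtain k0 :: 's where True by blast
  let ?T = "A <+> (B - {j0}) <+> (UNIV - {k0})"
  define g :: "'p + 'q + 's \<Rightarrow> ('p \<times> 'q \<times> 's) set"
    where "g = case_sum (\<lambda>i. {e. fst e = i})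
      (case_sum (\<lambda>j. {e. fst (snd e) = j}) (\<lambda>k. {e. snd (snd e) = k}))"
  have "card S \<le> card ?T"
  proof (rule card_indep_le[OF ind])
    fix d :: "real ^ ('p \<times> 'q \<times> 's)"
    assume sd: "supp d \<subseteq> S" and zero: "\<And>t. t \<in> ?T \<Longrightarrow> (\<Sum>e\<in>g t. d $ e) = 0"
    have off: "(\<Sum>e\<in>C. d $ e) = 0" if "C \<inter> over (A \<times> B) UNIV = {}" for C
      using sum_supp_cong[of C d "{}"] that sd S by auto
    have 1: "(\<Sum>e | fst e = i. d $ e) = 0" for i
    proof (cases "i \<in> A")
      case True
      then show ?thesis using zero[of "Inl i"] by (simp add: g_def InlI)
    qed (intro off, auto simp: over_def pr_def)
    have 2: "(\<Sum>e | fst (snd e) = j. d $ e) = 0" if "j \<noteq> j0" for j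
    proof (cases "j \<in> B")
      case True
      then show ?thesis using zero[of "Inr (Inl j)"] that by (simp add: g_def InlI InrI)
    qed (intro off, auto simp: over_def pr_def)
    have 3: "(\<Sum>e | snd (snd e) = k. d $ e) = 0" if "k \<noteq> k0" for k
      using zero[of "Inr (Inr k)"] that by (simp add: g_def InrI)
    have "(\<Sum>e\<in>UNIV. d $ e) = 0" by (rule sum_fibres_zero[of fst]) (simp add: 1)
    note total = this
    have "(\<Sum>e | fst (snd e) = j. d $ e) = 0" for j
      using total 2 by (rule fibre_zero_of_others)
    moreover have "(\<Sum>e | snd (snd e) = k. d $ e) = 0" for k
      using total 3 by (rule fibre_zero_of_others)
    ultimately show "d \<in> margin_kernel" using 1 by (simp add: margin_kernel_def)
  qed simp
  also have "card ?T = card A + (card B - 1 + (CARD('s) - 1))"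
    using j0 by (simp add: card_Plus)
  also have "\<dots> = card A + card B + CARD('s) - 2"
  proof -
    have "card B \<noteq> 0" "CARD('s) \<noteq> 0" using j0 by auto
    then show ?thesis by linarith
  qed
  finally show ?thesis .
qed

text \<open>If every row and every column had two cells, \<open>2 * card H\<close> and
  \<open>2 * card K\<close> would both be at most \<open>card S\<close>, against the forest
  bound.\<close>

lemma exists_leaf:
  assumes x: "x extreme_point_of P" and "2 \<le> card H" "2 \<le> card K"
  obtains h k where "h \<in> H" "k \<in> K"
    "over {h} (K - {k}) \<inter> supp x = {} \<or> over (H - {h}) {k} \<inter> supp x = {}"
proof -
  define S where "S = supp x \<inter> over H K"
  have ne: "H \<noteq> {}" "K \<noteq> {}" using assms(2,3) by auto
  have "indep S" by (rule indep_mono[of "supp x"]) (use x in \<open>simp_all add: S_def extreme_point_iff\<close>)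
  then have S: "card S \<le> card H + card K - 1"
    by (rule card_two_way_le) (use ne in \<open>auto simp: S_def\<close>)
  have "(\<exists>h\<in>H. card {e \<in> S. pr e = h} \<le> 1) \<or> (\<exists>k\<in>K. card {e \<in> S. snd (snd e) = k} \<le> 1)"
  proof (rule ccontr)
    assume "\<not> ?thesis"
    then have fib: "\<And>h. h \<in> H \<Longrightarrow> 2 \<le> card {e \<in> S. pr e = h}"
      "\<And>k. k \<in> K \<Longrightarrow> 2 \<le> card {e \<in> S. snd (snd e) = k}"
      by (simp_all add: not_le Suc_le_eq numeral_2_eq_2)
    have "pr ` S \<subseteq> H" "(\<lambda>e. snd (snd e)) ` S \<subseteq> K" by (auto simp: S_def over_def)
    then have "2 * card H \<le> card S" "2 * card K \<le> card S"
      using mult_card_le_of_fibres[OF finite finite _ fib(1)]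
        mult_card_le_of_fibres[OF finite finite _ fib(2)] by blast+
    then show False using S assms(2) by linarith
  qed
  then consider h where "h \<in> H" "card {e \<in> S. pr e = h} \<le> 1"
    | k where "k \<in> K" "card {e \<in> S. snd (snd e) = k} \<le> 1" by blast
  then show thesis
  proof cases
    case (1 h)
    \<comment> \<open>\<open>k\<close> is the column of the only cell in row \<open>h\<close>, or
      arbitrary if the row is empty.\<close>
    obtain k where k: "k \<in> K" "\<forall>e \<in> S. pr e = h \<longrightarrow> snd (snd e) = k"
    proof (cases "{e \<in> S. pr e = h} = {}")
      case True
      obtain k where "k \<in> K" using ne by blast
      then show ?thesis by (rule that) (use True in blast)
    next
      case False
      then have "card {e \<in> S. pr e = h} \<noteq> 0" by (subst card_0_eq) auto
      then have "card {e \<in> S. pr e = h} = 1" using 1(2) by linarith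
      then obtain a where a: "{e \<in> S. pr e = h} = {a}" by (rule card_1_singletonE)
      then have "a \<in> S" and only: "\<And>e. e \<in> S \<Longrightarrow> pr e = h \<Longrightarrow> e = a" by blast+
      then have "snd (snd a) \<in> K" by (simp add: S_def over_def)
      then show ?thesis by (rule that) (use only in blast)
    qed
    have "e \<notin> supp x" if "e \<in> over {h} (K - {k})" for e
    proof
      assume "e \<in> supp x"
      moreover have "pr e = h" "snd (snd e) \<in> K" "snd (snd e) \<noteq> k"
        using that by (simp_all add: over_def)
      moreover from calculation have "e \<in> S" using 1(1) unfolding S_def over_def by blast
      ultimately show False using k(2) by blast
    qed
    then have "over {h} (K - {k}) \<inter> supp x = {}" by blast
    then show ?thesis by (intro that[OF 1(1) k(1)] disjI1)
  next
    case (2 k)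
    obtain h where h: "h \<in> H" "\<forall>e \<in> S. snd (snd e) = k \<longrightarrow> pr e = h"
    proof (cases "{e \<in> S. snd (snd e) = k} = {}")
      case True
      obtain h where "h \<in> H" using ne by blast
      then show ?thesis by (rule that) (use True in blast)
    next
      case False
      then have "card {e \<in> S. snd (snd e) = k} \<noteq> 0" by (subst card_0_eq) auto
      then have "card {e \<in> S. snd (snd e) = k} = 1" using 2(2) by linarith
      then obtain a where a: "{e \<in> S. snd (snd e) = k} = {a}" by (rule card_1_singletonE)
      then have "a \<in> S" and only: "\<And>e. e \<in> S \<Longrightarrow> snd (snd e) = k \<Longrightarrow> e = a" by blast+
      then have "pr a \<in> H" by (simp add: S_def over_def)
      then show ?thesis by (rule that) (use only in blast)
    qed
    have "e \<notin> supp x" if "e \<in> over (H - {h}) {k}" for e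
    proof
      assume "e \<in> supp x"
      moreover have "snd (snd e) = k" "pr e \<in> H" "pr e \<noteq> h"
        using that by (simp_all add: over_def)
      moreover from calculation have "e \<in> S" using 2(1) unfolding S_def over_def by blast
      ultimately show False using h(2) by blast
    qed
    then have "over (H - {h}) {k} \<inter> supp x = {}" by blast
    then show ?thesis by (intro that[OF h(1) 2(1)] disjI2)
  qed
qed

section \<open>The two-way case\<close>

text \<open>
  \<open>F\<close> holds the cells on which all points of the current face agree already; the hypotheses on
  kernel elements express that the margins of the remaining \<open>H \<times> K\<close> block are determined.
\<close>

lemma near_two_way:
  assumes "x extreme_point_of P" "y extreme_point_of P"
    and "supp x \<subseteq> F \<union> over H K" "supp y \<subseteq> F \<union> over H K"
    and "H \<noteq> {}" "K \<noteq> {}" "F \<inter> over H K = {}"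
    and "\<And>d e. d \<in> margin_kernel \<Longrightarrow> supp d \<subseteq> F \<union> over H K \<Longrightarrow> e \<in> F \<Longrightarrow> d $ e = 0"
    and "\<And>d h. d \<in> margin_kernel \<Longrightarrow> supp d \<subseteq> F \<union> over H K \<Longrightarrow> h \<in> H \<Longrightarrow>
      (\<Sum>e\<in>over {h} K. d $ e) = 0"
    and "\<And>d k. d \<in> margin_kernel \<Longrightarrow> supp d \<subseteq> F \<union> over H K \<Longrightarrow> k \<in> K \<Longrightarrow>
      (\<Sum>e\<in>over H {k}. d $ e) = 0"
  shows "near P (\<Sum>{..<card H + card K}) x y"
  using assms
proof (induction "card H + card K" arbitrary: H K F y)
  case 0
  then show ?case by simp
next
  case (Suc n)
  have x: "x extreme_point_of P" "supp x \<subseteq> F \<union> over H K"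
    and y: "y extreme_point_of P" "supp y \<subseteq> F \<union> over H K" by fact+
  have xy: "x \<in> P" "y \<in> P" using x y by (auto simp: extreme_point_of_def)
  note zero = Suc.prems(8) and row = Suc.prems(9) and col = Suc.prems(10)
  have sum_point: "d $ (fst h, snd h, k) = (\<Sum>e\<in>over {h} {k}. d $ e)" for d :: "real ^ ('p \<times> 'q \<times> 's)" and h k
  proof -
    have "over {h} {k} = {(fst h, snd h, k)}" by (auto simp: over_def pr_def)
    then show ?thesis by simp
  qed
  show ?case
  proof (cases "card H = 1 \<or> card K = 1")
    case True
    define d where "d = x - y"
    have d: "d \<in> margin_kernel" "supp d \<subseteq> F \<union> over H K"
      using diff_in_N xy x y supp_diff[of x y] by (auto simp: d_def)
    \<comment> \<open>With a single row or column in the block, each of its cells is alone in its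
      column or row, so the determined sums fix it.\<close>
    have "d $ e = 0" for e
    proof (cases "e \<in> over H K")
      case e: True
      then have e': "pr e \<in> H" "snd (snd e) \<in> K" by (auto simp: over_def)
      have eq: "e = (fst (pr e), snd (pr e), snd (snd e))" by (simp add: pr_def)
      from True consider h where "H = {h}" | k where "K = {k}" by (metis card_1_singletonE)
      then show ?thesis
      proof cases
        case 1
        then have "H = {pr e}" using e' by auto
        then show ?thesis using col[OF d e'(2)] sum_point[of d "pr e" "snd (snd e)"] eq by metis
      next
        case 2
        then have "K = {snd (snd e)}" using e' by auto
        then show ?thesis using row[OF d e'(1)] sum_point[of d "pr e" "snd (snd e)"] eq by metis
      qed
    next
      case False
      then show ?thesis using d zero[OF d] by (cases "e \<in> F") (auto simp: supp_def)
    qed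
    then have "x = y" by (simp add: d_def vec_eq_iff)
    then show ?thesis by (simp add: near_refl)
  next
    case False
    then have "card H \<noteq> 0" "card K \<noteq> 0" "card H \<noteq> 1" "card K \<noteq> 1"
      using Suc.prems(5,6) by auto
    then have HK: "2 \<le> card H" "2 \<le> card K" by linarith+
    obtain h0 k0 where hk: "h0 \<in> H" "k0 \<in> K"
      and leaf: "over {h0} (K - {k0}) \<inter> supp x = {} \<or> over (H - {h0}) {k0} \<inter> supp x = {}"
      using exists_leaf[OF x(1) HK] by blast
    define I where "I = over {h0} (K - {k0})"
    define J where "J = over (H - {h0}) {k0}"
    \<comment> \<open>\<open>c\<close> is the corner shared by row \<open>h0\<close> and column
      \<open>k0\<close>; all exchanges feed it, and \<open>z e f\<close> is the opposite corner of
      the rectangle.\<close>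
    define c where "c = (fst h0, snd h0, k0)"
    have c: "over {h0} {k0} = {c}" by (auto simp: over_def pr_def c_def)
    define z where "z e f = (fst f, fst (snd f), snd (snd e))" for e f :: "'p \<times> 'q \<times> 's"
    have z: "z e f \<in> over (H - {h0}) (K - {k0})" if "e \<in> I" "f \<in> J" for e f
      using that by (auto simp: z_def I_def J_def over_def pr_def)
    have disj: "over (H - {h0}) (K - {k0}) \<inter> (I \<union> J \<union> {c}) = {}" "I \<inter> J = {}" "c \<notin> I" "c \<notin> J"
      by (auto simp: I_def J_def over_def pr_def c_def)
    have sub: "I \<subseteq> over H K" "J \<subseteq> over H K" "c \<in> over H K" "over (H - {h0}) (K - {k0}) \<subseteq> over H K"
      using hk by (auto simp: I_def J_def over_def pr_def c_def)
    have "\<exists>y'. y' extreme_point_of P \<and> supp y' \<subseteq> F \<union> over H K \<and>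
      (I \<inter> supp y' = {} \<or> J \<inter> supp y' = {}) \<and>
      near P (card (I \<inter> supp y) + card (J \<inter> supp y) + card ((\<lambda>_. c) ` (I \<inter> supp y) - supp y) - 1) y y'"
    proof (rule clear_cross[OF y, where z = z])
      show "c \<in> F \<union> over H K - I - J" using sub disj by auto
    next
      fix e f assume ef: "e \<in> I" "f \<in> J"
      show "z e f \<in> F \<union> over H K - I - J \<and> z e f \<noteq> c" using z[OF ef] sub disj by blast
      have "e = (fst h0, snd h0, snd (snd e))" "f = (fst f, fst (snd f), k0)"
        using ef by (auto simp: I_def J_def over_def pr_def)
      then show "axis c 1 + axis (z e f) 1 - axis e 1 - axis f 1 \<in> margin_kernel"
        unfolding c_def z_def using exchange_last by metis
    qed
    then obtain y' where y': "y' extreme_point_of P" "supp y' \<subseteq> F \<union> over H K"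
      "I \<inter> supp y' = {} \<or> J \<inter> supp y' = {}" and
      near: "near P (card (I \<inter> supp y) + card (J \<inter> supp y) + card ((\<lambda>_. c) ` (I \<inter> supp y) - supp y) - 1) y y'"
      by blast
    have "card (I \<inter> supp y) + card (J \<inter> supp y) = card ((I \<union> J) \<inter> supp y)"
      using disj(2) by (subst card_Un_disjoint[symmetric]) (auto intro!: arg_cong[of _ _ card])
    also have "\<dots> \<le> card (supp y \<inter> over H K)" using sub by (intro card_mono) auto
    also have "\<dots> \<le> card H + card K - 1"
    proof (rule card_two_way_le)
      show "indep (supp y \<inter> over H K)"
        by (rule indep_mono[of "supp y"]) (use y(1) in \<open>simp_all add: extreme_point_iff\<close>)
    qed (use hk in auto)
    finally have "card (I \<inter> supp y) + card (J \<inter> supp y) \<le> n" using Suc.hyps(2) by linarith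
    \<comment> \<open>The constant target makes the last summand of the potential at most 1, which
      the \<open>- 1\<close> cancels; so \<open>n\<close> pivots are enough.\<close>
    moreover have "card ((\<lambda>_. c) ` (I \<inter> supp y) - supp y) \<le> card {c}" by (intro card_mono) auto
    ultimately have near': "near P n y y'" by (intro near_mono[OF near]) simp
    have y'P: "y' \<in> P" using y' by (auto simp: extreme_point_of_def)
    have d: "x - y' \<in> margin_kernel" "supp (x - y') \<subseteq> F \<union> over H K"
      using diff_in_N xy y'P x y' supp_diff[of x y'] by auto
    have QI: "{c} \<union> I = over {h0} K" and QJ: "{c} \<union> J = over H {k0}"
      using hk by (auto simp: I_def J_def over_def pr_def c_def)
    have "I \<inter> (supp x \<union> supp y') = {} \<or> J \<inter> (supp x \<union> supp y') = {}"
    proof (rule cross_empty_same[OF xy(1) y'P, of "{c}"])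
      show "(\<Sum>e\<in>{c} \<union> I. (x - y') $ e) = 0" unfolding QI using row[OF d hk(1)] .
      show "(\<Sum>e\<in>{c} \<union> J. (x - y') $ e) = 0" unfolding QJ using col[OF d hk(2)] .
    qed (use disj leaf y' in \<open>auto simp: I_def J_def\<close>)
    then have "near P (\<Sum>{..<n}) x y'"
    proof
      assume I: "I \<inter> (supp x \<union> supp y') = {}"
      have split: "F \<union> over H K = insert c F \<union> over (H - {h0}) K \<union> I"
        using hk by (auto simp: I_def over_def pr_def c_def)
      have n: "n = card (H - {h0}) + card K" using Suc.hyps(2) hk HK by simp
      \<comment> \<open>With \<open>I\<close> empty, \<open>c\<close> is the only cell of row
        \<open>h0\<close> left, so the row sum determines it: \<open>c\<close> joins
        \<open>F\<close> and the row leaves the block.\<close>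
      have c0: "d $ c = 0" and rest: "supp d \<inter> over {h0} K = {}"
        if d: "d \<in> margin_kernel" "supp d \<subseteq> insert c F \<union> over (H - {h0}) K" for d
      proof -
        have FH: "supp d \<subseteq> F \<union> over H K" using d(2) split by blast
        have "I \<inter> supp d = {}"
          using d(2) disj(3) Suc.prems(7) sub(1) by (fastforce simp: I_def over_def)
        then have "(\<Sum>e\<in>over {h0} K. d $ e) = (\<Sum>e\<in>{c}. d $ e)"
          unfolding QI[symmetric] by (intro sum_supp_cong) auto
        then show c0: "d $ c = 0" using row[OF d(1) FH hk(1)] by simp
        show "supp d \<inter> over {h0} K = {}"
          unfolding QI[symmetric] using c0 \<open>I \<inter> supp d = {}\<close> by (auto simp: supp_def)
      qed
      have sub': "supp d \<subseteq> F \<union> over H K" if "supp d \<subseteq> insert c F \<union> over (H - {h0}) K" for d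
        using that split by blast
      show "near P (\<Sum>{..<n}) x y'"
        unfolding n
      proof (rule Suc.hyps(1)[OF n x(1) y'(1)])
        show "supp x \<subseteq> insert c F \<union> over (H - {h0}) K" "supp y' \<subseteq> insert c F \<union> over (H - {h0}) K"
          using x(2) y'(2) I split by blast+
        have "card (H - {h0}) \<noteq> 0" using HK hk by simp
        then show "H - {h0} \<noteq> {}" by auto
        show "K \<noteq> {}" by fact
        show "insert c F \<inter> over (H - {h0}) K = {}"
          using Suc.prems(7) by (auto simp: over_def c_def pr_def)
      next
        fix d e assume d: "d \<in> margin_kernel" "supp d \<subseteq> insert c F \<union> over (H - {h0}) K" "e \<in> insert c F"
        then show "d $ e = 0" using c0[OF d(1,2)] zero[OF d(1) sub'[OF d(2)]] by blast
      next
        fix d h assume d: "d \<in> margin_kernel" "supp d \<subseteq> insert c F \<union> over (H - {h0}) K" "h \<in> H - {h0}"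
        then show "(\<Sum>e\<in>over {h} K. d $ e) = 0" using row[OF d(1) sub'[OF d(2)]] by auto
      next
        fix d k assume d: "d \<in> margin_kernel" "supp d \<subseteq> insert c F \<union> over (H - {h0}) K" "k \<in> K"
        have "(\<Sum>e\<in>over (H - {h0}) {k}. d $ e) = (\<Sum>e\<in>over H {k}. d $ e)"
          using rest[OF d(1,2)] d(3) by (intro sum_supp_cong) (auto simp: over_def)
        then show "(\<Sum>e\<in>over (H - {h0}) {k}. d $ e) = 0"
          using col[OF d(1) sub'[OF d(2)] d(3)] by simp
      qed
    next
      assume J: "J \<inter> (supp x \<union> supp y') = {}"
      have split: "F \<union> over H K = insert c F \<union> over H (K - {k0}) \<union> J"
        using hk by (auto simp: J_def over_def pr_def c_def)
      have n: "n = card H + card (K - {k0})" using Suc.hyps(2) hk HK by simp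
      have c0: "d $ c = 0" and rest: "supp d \<inter> over H {k0} = {}"
        if d: "d \<in> margin_kernel" "supp d \<subseteq> insert c F \<union> over H (K - {k0})" for d
      proof -
        have FH: "supp d \<subseteq> F \<union> over H K" using d(2) split by blast
        have "J \<inter> supp d = {}"
          using d(2) disj(4) Suc.prems(7) sub(2) by (fastforce simp: J_def over_def)
        then have "(\<Sum>e\<in>over H {k0}. d $ e) = (\<Sum>e\<in>{c}. d $ e)"
          unfolding QJ[symmetric] by (intro sum_supp_cong) auto
        then show c0: "d $ c = 0" using col[OF d(1) FH hk(2)] by simp
        show "supp d \<inter> over H {k0} = {}"
          unfolding QJ[symmetric] using c0 \<open>J \<inter> supp d = {}\<close> by (auto simp: supp_def)
      qed
      have sub': "supp d \<subseteq> F \<union> over H K" if "supp d \<subseteq> insert c F \<union> over H (K - {k0})" for d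
        using that split by blast
      show "near P (\<Sum>{..<n}) x y'"
        unfolding n
      proof (rule Suc.hyps(1)[OF n x(1) y'(1)])
        show "supp x \<subseteq> insert c F \<union> over H (K - {k0})" "supp y' \<subseteq> insert c F \<union> over H (K - {k0})"
          using x(2) y'(2) J split by blast+
        show "H \<noteq> {}" by fact
        have "card (K - {k0}) \<noteq> 0" using HK hk by simp
        then show "K - {k0} \<noteq> {}" by auto
        show "insert c F \<inter> over H (K - {k0}) = {}"
          using Suc.prems(7) by (auto simp: over_def c_def pr_def)
      next
        fix d e assume d: "d \<in> margin_kernel" "supp d \<subseteq> insert c F \<union> over H (K - {k0})" "e \<in> insert c F"
        then show "d $ e = 0" using c0[OF d(1,2)] zero[OF d(1) sub'[OF d(2)]] by blast
      next
        fix d h assume d: "d \<in> margin_kernel" "supp d \<subseteq> insert c F \<union> over H (K - {k0})" "h \<in> H"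
        have "(\<Sum>e\<in>over {h} (K - {k0}). d $ e) = (\<Sum>e\<in>over {h} K. d $ e)"
          using rest[OF d(1,2)] d(3) by (intro sum_supp_cong) (auto simp: over_def)
        then show "(\<Sum>e\<in>over {h} (K - {k0}). d $ e) = 0"
          using row[OF d(1) sub'[OF d(2)] d(3)] by simp
      next
        fix d k assume d: "d \<in> margin_kernel" "supp d \<subseteq> insert c F \<union> over H (K - {k0})" "k \<in> K - {k0}"
        then show "(\<Sum>e\<in>over H {k}. d $ e) = 0" using col[OF d(1) sub'[OF d(2)]] by auto
      qed
    qed
    \<comment> \<open>Only \<open>y\<close> was moved, by at most \<open>n\<close> pivots; this adds
      the last term \<open>n\<close> of the sum.\<close>
    then have "near P (\<Sum>{..<n} + n) x y" using near_trans near_sym[OF near'] by blast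
    then show ?thesis unfolding Suc.hyps(2)[symmetric] by (simp add: lessThan_Suc add.commute)
  qed
qed

section \<open>Elimination of the first two indices\<close>

text \<open>The margin of slice \<open>i\<close> splits into finished pairs, whose sums are
  determined one by one, and the part inside \<open>A \<times> B\<close>.\<close>

lemma row_box_zero:
  assumes d: "d \<in> margin_kernel" "supp d \<subseteq> over (H0 \<union> A \<times> B) UNIV"
    and "H0 \<inter> A \<times> B = {}" and H0: "\<And>h. h \<in> H0 \<Longrightarrow> (\<Sum>e\<in>over {h} UNIV. d $ e) = 0" and "i \<in> A"
  shows "(\<Sum>e\<in>over ({i} \<times> B) UNIV. d $ e) = 0"
proof -
  let ?H = "{h \<in> H0. fst h = i}"
  have "0 = (\<Sum>e | fst e = i. d $ e)" using d(1) by (simp add: margin_kernel_def)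
  also have "\<dots> = (\<Sum>e\<in>over ?H UNIV \<union> over ({i} \<times> B) UNIV. d $ e)"
  proof (rule sum_supp_cong)
    have "fst e = i \<longleftrightarrow> e \<in> over ?H UNIV \<union> over ({i} \<times> B) UNIV" if "e \<in> supp d" for e
    proof -
      have "pr e \<in> H0 \<union> A \<times> B" using that d(2) by (auto simp: over_def)
      then show ?thesis using \<open>i \<in> A\<close> by (auto simp: over_def pr_def)
    qed
    then show "{e. fst e = i} \<inter> supp d = (over ?H UNIV \<union> over ({i} \<times> B) UNIV) \<inter> supp d" by blast
  qed
  also have "\<dots> = (\<Sum>e\<in>over ?H UNIV. d $ e) + (\<Sum>e\<in>over ({i} \<times> B) UNIV. d $ e)"
    using assms(3,5) by (intro sum.union_disjoint) (auto simp: over_def pr_def)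
  also have "(\<Sum>e\<in>over ?H UNIV. d $ e) = 0" by (rule sum_over_rows_zero) (simp add: H0)
  finally show ?thesis by simp
qed

lemma col_box_zero:
  assumes d: "d \<in> margin_kernel" "supp d \<subseteq> over (H0 \<union> A \<times> B) UNIV"
    and "H0 \<inter> A \<times> B = {}" and H0: "\<And>h. h \<in> H0 \<Longrightarrow> (\<Sum>e\<in>over {h} UNIV. d $ e) = 0" and "j \<in> B"
  shows "(\<Sum>e\<in>over (A \<times> {j}) UNIV. d $ e) = 0"
proof -
  let ?H = "{h \<in> H0. snd h = j}"
  have "0 = (\<Sum>e | fst (snd e) = j. d $ e)" using d(1) by (simp add: margin_kernel_def)
  also have "\<dots> = (\<Sum>e\<in>over ?H UNIV \<union> over (A \<times> {j}) UNIV. d $ e)"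
  proof (rule sum_supp_cong)
    have "fst (snd e) = j \<longleftrightarrow> e \<in> over ?H UNIV \<union> over (A \<times> {j}) UNIV" if "e \<in> supp d" for e
    proof -
      have "pr e \<in> H0 \<union> A \<times> B" using that d(2) by (auto simp: over_def)
      then show ?thesis using \<open>j \<in> B\<close> by (auto simp: over_def pr_def)
    qed
    then show "{e. fst (snd e) = j} \<inter> supp d = (over ?H UNIV \<union> over (A \<times> {j}) UNIV) \<inter> supp d" by blast
  qed
  also have "\<dots> = (\<Sum>e\<in>over ?H UNIV. d $ e) + (\<Sum>e\<in>over (A \<times> {j}) UNIV. d $ e)"
    using assms(3,5) by (intro sum.union_disjoint) (auto simp: over_def pr_def)
  also have "(\<Sum>e\<in>over ?H UNIV. d $ e) = 0" by (rule sum_over_rows_zero) (simp add: H0)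
  finally show ?thesis by simp
qed

text \<open>The elimination step for one vertex: \<open>clear_cross\<close> for two slices crossing
  in the pair \<open>(i0, j0)\<close>. Their cells belong to an independent support inside the box,
  which gives the first part of the count; the second \<open>CARD('s)\<close> allows one pivot for
  each possible target.\<close>

lemma clear_pair:
  assumes x: "x extreme_point_of P" "supp x \<subseteq> over (H0 \<union> A \<times> B) UNIV"
    and "H0 \<inter> A \<times> B = {}" "i0 \<in> A" "j0 \<in> B"
  shows "\<exists>y. y extreme_point_of P \<and> supp y \<subseteq> over (H0 \<union> A \<times> B) UNIV \<and>
    (over ({i0} \<times> (B - {j0})) UNIV \<inter> supp y = {} \<or> over ((A - {i0}) \<times> {j0}) UNIV \<inter> supp y = {}) \<and>
    near P (card A + card B + CARD('s) - 2 + CARD('s) - 1) x y"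
proof -
  define I where "I = over ({i0} \<times> (B - {j0})) (UNIV :: 's set)"
  define J where "J = over ((A - {i0}) \<times> {j0}) (UNIV :: 's set)"
  define Q where "Q = over {(i0, j0)} (UNIV :: 's set)"
  define Z where "Z = over ((A - {i0}) \<times> (B - {j0})) (UNIV :: 's set)"
  \<comment> \<open>\<open>q e\<close> keeps the third index of \<open>e\<close> and
    \<open>z e f\<close> that of \<open>f\<close>, so there are at most \<open>CARD('s)\<close>
    targets.\<close>
  define q where "q e = (i0, j0, snd (snd e))" for e :: "'p \<times> 'q \<times> 's"
  define z where "z e f = (fst f, fst (snd e), snd (snd f))" for e f :: "'p \<times> 'q \<times> 's"
  have q: "q e \<in> Q" for e by (simp add: q_def Q_def)
  have z: "z e f \<in> Z" if "e \<in> I" "f \<in> J" for e f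
    using that by (simp add: z_def Z_def I_def J_def over_def pr_def mem_Times_iff)
  have disj: "Q \<inter> I = {}" "Q \<inter> J = {}" "Z \<inter> I = {}" "Z \<inter> J = {}" "Z \<inter> Q = {}" "I \<inter> J = {}"
    by (auto simp: I_def J_def Q_def Z_def over_def)
  have sub: "Q \<subseteq> over (A \<times> B) UNIV" "I \<subseteq> over (A \<times> B) UNIV" "J \<subseteq> over (A \<times> B) UNIV"
    "Z \<subseteq> over (A \<times> B) UNIV" "over (A \<times> B) UNIV \<subseteq> over (H0 \<union> A \<times> B) (UNIV :: 's set)"
    using assms(4,5) by (auto simp: I_def J_def Q_def Z_def over_def)
  have "\<exists>y. y extreme_point_of P \<and> supp y \<subseteq> over (H0 \<union> A \<times> B) UNIV \<and>
    (I \<inter> supp y = {} \<or> J \<inter> supp y = {}) \<and>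
    near P (card (I \<inter> supp x) + card (J \<inter> supp x) + card (q ` (I \<inter> supp x) - supp x) - 1) x y"
  proof (rule clear_cross[OF x, where z = z])
    fix e
    have "q e \<in> over (H0 \<union> A \<times> B) UNIV" by (rule subsetD[OF sub(5) subsetD[OF sub(1) q]])
    moreover have "q e \<notin> I" "q e \<notin> J" using q[of e] disj(1,2) by blast+
    ultimately show "q e \<in> over (H0 \<union> A \<times> B) UNIV - I - J" by (intro DiffI)
  next
    fix e f assume ef: "e \<in> I" "f \<in> J"
    have "z e f \<in> over (H0 \<union> A \<times> B) UNIV"
      by (rule subsetD[OF sub(5) subsetD[OF sub(4) z[OF ef]]])
    moreover have "z e f \<notin> I" "z e f \<notin> J" "z e f \<notin> Q" using z[OF ef] disj(3-5) by blast+
    ultimately show "z e f \<in> over (H0 \<union> A \<times> B) UNIV - I - J \<and> z e f \<noteq> q e"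
      using q[of e] by (intro conjI DiffI) auto
    obtain b c where e: "e = (i0, b, c)" using ef(1) by (cases e) (simp add: I_def)
    obtain a c' where f: "f = (a, j0, c')" using ef(2) by (cases f) (simp add: J_def)
    show "axis (q e) 1 + axis (z e f) 1 - axis e 1 - axis f 1 \<in> margin_kernel"
      unfolding e f q_def z_def fst_conv snd_conv by (rule exchange_mixed)
  qed
  then obtain y where y: "y extreme_point_of P" "supp y \<subseteq> over (H0 \<union> A \<times> B) UNIV"
    "I \<inter> supp y = {} \<or> J \<inter> supp y = {}"
    and near: "near P (card (I \<inter> supp x) + card (J \<inter> supp x) + card (q ` (I \<inter> supp x) - supp x) - 1) x y"
    by blast
  have "card (I \<inter> supp x) + card (J \<inter> supp x) = card (I \<inter> supp x \<union> J \<inter> supp x)"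
    using disj by (subst card_Un_disjoint) auto
  also have "\<dots> \<le> card (supp x \<inter> over (A \<times> B) UNIV)" using sub by (intro card_mono) auto
  also have "\<dots> \<le> card A + card B + CARD('s) - 2"
  proof (rule card_box_le)
    show "indep (supp x \<inter> over (A \<times> B) UNIV)"
      by (rule indep_mono[of "supp x"]) (use x(1) in \<open>simp_all add: extreme_point_iff\<close>)
  qed (use assms(5) in auto)
  finally have IJ: "card (I \<inter> supp x) + card (J \<inter> supp x) \<le> card A + card B + CARD('s) - 2" .
  have "q ` (I \<inter> supp x) - supp x \<subseteq> (\<lambda>k. (i0, j0, k)) ` (UNIV :: 's set)" by (auto simp: q_def)
  then have "card (q ` (I \<inter> supp x) - supp x) \<le> CARD('s)"
    using surj_card_le[of "UNIV :: 's set"] by simp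
  then have "near P (card A + card B + CARD('s) - 2 + CARD('s) - 1) x y"
    using IJ by (intro near_mono[OF near]) simp
  then show ?thesis using y unfolding I_def J_def by blast
qed

text \<open>\<open>H0\<close> collects the finished pairs, \<open>A\<close> and \<open>B\<close> the indices not yet eliminated.\<close>

lemma near_axial:
  assumes "x extreme_point_of P" "y extreme_point_of P"
    and "supp x \<subseteq> over (H0 \<union> A \<times> B) UNIV" "supp y \<subseteq> over (H0 \<union> A \<times> B) UNIV"
    and "A \<noteq> {}" "B \<noteq> {}" "H0 \<inter> A \<times> B = {}" "card H0 + card A + card B \<le> M"
    and "\<And>(d :: real ^ ('p \<times> 'q \<times> 's)) h.
      d \<in> margin_kernel \<Longrightarrow> supp d \<subseteq> over (H0 \<union> A \<times> B) UNIV \<Longrightarrow> h \<in> H0 \<Longrightarrow>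
      (\<Sum>e\<in>over {h} UNIV. d $ e) = 0"
  shows "near P ((\<Sum>t<card A + card B - 2. 2 * (t + 2 * CARD('s))) + \<Sum>{..<M - 1 + CARD('s)}) x y"
  using assms
proof (induction "card A + card B" arbitrary: A B H0 x y)
  case 0
  then show ?case by simp
next
  case (Suc n)
  let ?H = "H0 \<union> A \<times> B"
  let ?g = "\<Sum>{..<M - 1 + CARD('s)}"
  have x: "x extreme_point_of P" "supp x \<subseteq> over ?H UNIV"
    and y: "y extreme_point_of P" "supp y \<subseteq> over ?H UNIV" by fact+
  have disj: "H0 \<inter> A \<times> B = {}" by fact
  note inv = Suc.prems(9)
  have pos: "card A \<noteq> 0" "card B \<noteq> 0" using Suc.prems(5,6) by auto
  show ?case
  proof (cases "card A = 1 \<or> card B = 1")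
    case True
    \<comment> \<open>The pair sums are now determined in the box too: with one index left on one
      side, each pair is the whole box slice of its other index.\<close>
    have row: "(\<Sum>e\<in>over {h} UNIV. d $ e) = 0"
      if d: "d \<in> margin_kernel" "supp d \<subseteq> over ?H UNIV" "h \<in> ?H" for d :: "real ^ ('p \<times> 'q \<times> 's)" and h
    proof (cases "h \<in> H0")
      case True
      then show ?thesis by (rule inv[OF d(1,2)])
    next
      case False
      then obtain i j where h: "h = (i, j)" "i \<in> A" "j \<in> B" using d(3) by blast
      from True show ?thesis
      proof
        assume "card A = 1"
        then have "A = {i}" using h(2) by (metis card_1_singletonE singletonD)
        then show ?thesis
          using col_box_zero[OF d(1,2) disj inv[OF d(1,2)] h(3)] h(1) by simp
      next
        assume "card B = 1"
        then have "B = {j}" using h(3) by (metis card_1_singletonE singletonD)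
        then show ?thesis
          using row_box_zero[OF d(1,2) disj inv[OF d(1,2)] h(2)] h(1) by simp
      qed
    qed
    have "near P (\<Sum>{..<card ?H + CARD('s)}) x y"
    proof (rule near_two_way[of x y "{}" ?H UNIV])
      show "supp x \<subseteq> {} \<union> over ?H UNIV" "supp y \<subseteq> {} \<union> over ?H UNIV" using x y by simp_all
      show "?H \<noteq> {}" using Suc.prems(5,6) by simp
    next
      fix d :: "real ^ ('p \<times> 'q \<times> 's)" and h
      assume "d \<in> margin_kernel" "supp d \<subseteq> {} \<union> over ?H UNIV" "h \<in> ?H"
      then show "(\<Sum>e\<in>over {h} UNIV. d $ e) = 0" unfolding Un_empty_left by (rule row)
    next
      fix d k assume d: "d \<in> margin_kernel" "supp d \<subseteq> {} \<union> over ?H (UNIV :: 's set)"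
      have "(\<Sum>e\<in>over ?H {k}. d $ e) = (\<Sum>e | snd (snd e) = k. d $ e)"
        using d(2) by (intro sum_supp_cong) (auto simp: over_def)
      then show "(\<Sum>e\<in>over ?H {k}. d $ e) = 0" using d(1) by (simp add: margin_kernel_def)
    qed (use x y in auto)
    moreover have "card ?H \<le> M - 1"
    proof -
      have "card ?H \<le> card H0 + card A * card B"
        using card_Un_le[of H0 "A \<times> B"] by (simp add: card_cartesian_product)
      \<comment> \<open>One factor is 1, which turns the product into a sum, so box and finished
        pairs together number at most \<open>M - 1\<close>.\<close>
      also have "card A * card B = card A + card B - 1" using True pos by auto
      finally show ?thesis using Suc.prems(8) pos by linarith
    qed
    then have "\<Sum>{..<card ?H + CARD('s)} \<le> ?g" by (intro sum_mono2) auto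
    ultimately show ?thesis using near_mono trans_le_add2 by blast
  next
    case False
    then have AB: "2 \<le> card A" "2 \<le> card B" using pos by linarith+
    obtain i0 j0 where ij: "i0 \<in> A" "j0 \<in> B" using Suc.prems(5,6) by blast
    let ?I = "over ({i0} \<times> (B - {j0})) (UNIV :: 's set)"
    let ?J = "over ((A - {i0}) \<times> {j0}) (UNIV :: 's set)"
    let ?Q = "over {(i0, j0)} (UNIV :: 's set)"
    let ?c = "card A + card B + CARD('s) - 2 + CARD('s) - 1"
    obtain x' where x': "x' extreme_point_of P" "supp x' \<subseteq> over ?H UNIV"
      "?I \<inter> supp x' = {} \<or> ?J \<inter> supp x' = {}" "near P ?c x x'"
      using clear_pair[OF x disj ij] by blast
    obtain y' where y': "y' extreme_point_of P" "supp y' \<subseteq> over ?H UNIV"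
      "?I \<inter> supp y' = {} \<or> ?J \<inter> supp y' = {}" "near P ?c y y'"
      using clear_pair[OF y disj ij] by blast
    have P': "x' \<in> P" "y' \<in> P" using x'(1) y'(1) by (simp_all add: extreme_point_of_def)
    have d: "x' - y' \<in> margin_kernel" "supp (x' - y') \<subseteq> over ?H UNIV"
      using diff_in_N[OF P'] x'(2) y'(2) supp_diff[of x' y'] by blast+
    have QI: "?Q \<union> ?I = over ({i0} \<times> B) UNIV" and QJ: "?Q \<union> ?J = over (A \<times> {j0}) UNIV"
      using ij by (auto simp: over_def)
    \<comment> \<open>The sums over both box slices agree for \<open>x'\<close> and
      \<open>y'\<close>, so the same index can be eliminated for both.\<close>
    have "?I \<inter> (supp x' \<union> supp y') = {} \<or> ?J \<inter> (supp x' \<union> supp y') = {}"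
    proof (rule cross_empty_same[OF P', of ?Q])
      show "(\<Sum>e\<in>?Q \<union> ?I. (x' - y') $ e) = 0"
        unfolding QI by (rule row_box_zero[OF d disj inv[OF d] ij(1)])
      show "(\<Sum>e\<in>?Q \<union> ?J. (x' - y') $ e) = 0"
        unfolding QJ by (rule col_box_zero[OF d disj inv[OF d] ij(2)])
      show "?Q \<inter> ?I = {}" "?Q \<inter> ?J = {}" by (auto simp: over_def)
    qed (fact x'(3) y'(3))+
    then have "near P ((\<Sum>t<n - 2. 2 * (t + 2 * CARD('s))) + ?g) x' y'"
    proof
      let ?H' = "insert (i0, j0) H0 \<union> (A - {i0}) \<times> B"
      assume I: "?I \<inter> (supp x' \<union> supp y') = {}"
      have split: "over ?H UNIV = over ?H' (UNIV :: 's set) \<union> ?I" using ij by (auto simp: over_def)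
      have n: "n = card (A - {i0}) + card B" using Suc.hyps(2) ij AB by simp
      show ?thesis
        unfolding n
      proof (rule Suc.hyps(1)[OF n x'(1) y'(1)])
        show "supp x' \<subseteq> over ?H' UNIV" "supp y' \<subseteq> over ?H' UNIV"
          using x'(2) y'(2) I unfolding split by blast+
        have "card (A - {i0}) \<noteq> 0" using AB ij by simp
        then show "A - {i0} \<noteq> {}" by auto
        show "B \<noteq> {}" by fact
        show "insert (i0, j0) H0 \<inter> (A - {i0}) \<times> B = {}" using disj by blast
        \<comment> \<open>At most one pair is added while one index is lost, so the bound
          \<open>M\<close> persists.\<close>
        have "card (insert (i0, j0) H0) \<le> Suc (card H0)" by (simp add: card_insert_if)
        then show "card (insert (i0, j0) H0) + card (A - {i0}) + card B \<le> M"
          using Suc.prems(8) Suc.hyps(2) n by linarith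
      next
        fix d :: "real ^ ('p \<times> 'q \<times> 's)" and h
        assume d: "d \<in> margin_kernel" "supp d \<subseteq> over ?H' UNIV" and h: "h \<in> insert (i0, j0) H0"
        have sd: "supp d \<subseteq> over ?H UNIV" using d(2) unfolding split by blast
        \<comment> \<open>The pair \<open>(i0, j0)\<close> now carries the whole part of slice
          \<open>i0\<close> inside the box, so its sum is determined and it may join
          \<open>H0\<close>.\<close>
        have "?I \<inter> over ?H' UNIV = {}" using disj ij by (auto simp: over_def)
        then have "(\<Sum>e\<in>?Q. d $ e) = (\<Sum>e\<in>?Q \<union> ?I. d $ e)"
          using d(2) by (intro sum_supp_cong) blast
        also have "\<dots> = 0" unfolding QI by (rule row_box_zero[OF d(1) sd disj inv[OF d(1) sd] ij(1)])
        finally have "(\<Sum>e\<in>?Q. d $ e) = 0" .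
        then show "(\<Sum>e\<in>over {h} UNIV. d $ e) = 0"
          using h inv[OF d(1) sd, of h] by (cases "h = (i0, j0)") simp_all
      qed
    next
      let ?H' = "insert (i0, j0) H0 \<union> A \<times> (B - {j0})"
      assume J: "?J \<inter> (supp x' \<union> supp y') = {}"
      have split: "over ?H UNIV = over ?H' (UNIV :: 's set) \<union> ?J" using ij by (auto simp: over_def)
      have n: "n = card A + card (B - {j0})" using Suc.hyps(2) ij AB by simp
      show ?thesis
        unfolding n
      proof (rule Suc.hyps(1)[OF n x'(1) y'(1)])
        show "supp x' \<subseteq> over ?H' UNIV" "supp y' \<subseteq> over ?H' UNIV"
          using x'(2) y'(2) J unfolding split by blast+
        show "A \<noteq> {}" by fact
        have "card (B - {j0}) \<noteq> 0" using AB ij by simp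
        then show "B - {j0} \<noteq> {}" by auto
        show "insert (i0, j0) H0 \<inter> A \<times> (B - {j0}) = {}" using disj by blast
        have "card (insert (i0, j0) H0) \<le> Suc (card H0)" by (simp add: card_insert_if)
        then show "card (insert (i0, j0) H0) + card A + card (B - {j0}) \<le> M"
          using Suc.prems(8) Suc.hyps(2) n by linarith
      next
        fix d :: "real ^ ('p \<times> 'q \<times> 's)" and h
        assume d: "d \<in> margin_kernel" "supp d \<subseteq> over ?H' UNIV" and h: "h \<in> insert (i0, j0) H0"
        have sd: "supp d \<subseteq> over ?H UNIV" using d(2) unfolding split by blast
        have "?J \<inter> over ?H' UNIV = {}" using disj ij by (auto simp: over_def)
        then have "(\<Sum>e\<in>?Q. d $ e) = (\<Sum>e\<in>?Q \<union> ?J. d $ e)"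
          using d(2) by (intro sum_supp_cong) blast
        also have "\<dots> = 0" unfolding QJ by (rule col_box_zero[OF d(1) sd disj inv[OF d(1) sd] ij(2)])
        finally have "(\<Sum>e\<in>?Q. d $ e) = 0" .
        then show "(\<Sum>e\<in>over {h} UNIV. d $ e) = 0"
          using h inv[OF d(1) sd, of h] by (cases "h = (i0, j0)") simp_all
      qed
    qed
    then have "near P (?c + ((\<Sum>t<n - 2. 2 * (t + 2 * CARD('s))) + ?g) + ?c) x y"
      using near_trans[OF near_trans[OF x'(4)] near_sym[OF y'(4)]] by blast
    \<comment> \<open>The sum gains its top term, at \<open>t = n - 2\<close>: each of the two
      vertices costs \<open>t + 2 * CARD('s)\<close>.\<close>
    moreover have k: "card A + card B - 2 = Suc (n - 2)" and c: "?c = n - 2 + 2 * CARD('s)"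
      using Suc.hyps(2) AB by linarith+
    have "?c + ((\<Sum>t<n - 2. 2 * (t + 2 * CARD('s))) + ?g) + ?c =
      (\<Sum>t<card A + card B - 2. 2 * (t + 2 * CARD('s))) + ?g"
      unfolding c k by simp
    ultimately show ?thesis by (simp only:)
  qed
qed

text \<open>The start has no finished pair and all indices left, so \<open>M\<close> is
  \<open>CARD('p) + CARD('q)\<close>.\<close>

lemma near_vertices:
  assumes x: "x extreme_point_of P" and y: "y extreme_point_of P"
  shows "near P (2 * (CARD('p) + CARD('q) + CARD('s) - 2)\<^sup>2) x y"
proof -
  have all: "over UNIV UNIV = UNIV" by (simp add: over_def)
  have "near P ((\<Sum>t<CARD('p) + CARD('q) - 2. 2 * (t + 2 * CARD('s)))
      + \<Sum>{..<CARD('p) + CARD('q) - 1 + CARD('s)}) x y"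
    by (rule near_axial[OF x y, of "{}"]) (simp_all add: all)
  then show ?thesis
    by (rule near_mono) (intro two_phase_bound; simp add: Suc_le_eq)
qed

end

theorem theorem3p3:
  fixes u :: "real ^ 'p::finite" and v :: "real ^ 'q::finite" and w :: "real ^ 's::finite"
  shows "graph_diameter (with_proj (polytope_graph (transportation_polytope u v w)))
           \<le> ereal (real (2 * (CARD('p) + CARD('q) + CARD('s) - 2)\<^sup>2))"
proof (rule graph_diameter_le)
  let ?P = "transportation_polytope u v w"
  fix x y assume x: "x extreme_point_of ?P" and y: "y extreme_point_of ?P"
  then have "x \<in> ?P" by (simp add: extreme_point_of_def)
  \<comment> \<open>The vertex \<open>x\<close> itself serves as base point; without vertices there
    is nothing to show.\<close>
  interpret axial ?P x
    by unfold_locales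
      (use subspace_margin_kernel margin_kernel_nonneg transportation_polytope_eq[OF \<open>x \<in> ?P\<close>] in blast)+
  show "near ?P (2 * (CARD('p) + CARD('q) + CARD('s) - 2)\<^sup>2) x y"
    by (rule near_vertices[OF x y])
qed

end
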